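(* Let $\lambda\in[0,1)$, $\delta>0$, let $(\alpha,S)$ be a phase-type job size distribution with mean $1$, and let $y=\alpha(\delta I-S)^{-1}s^*$. For the queue at the cavity of the water filling policy with arrival rate $\lambda$ and probe rate $\delta$, with parameters $(m,c)$, we have $m=\lfloor\tilde m\rfloor$ with $$\tilde m=\frac{\log\left(\frac1y+\left(\frac{\lambda}{\delta(1-\lambda)}-1\right)\frac{1-y}{y}\right)}{\log(1/y)},$$ and $c\in[0,1)$ is the unique value such that $$1-\lambda=\frac{y^{m-1}/\delta}{1/\delta+\kappa(-K)^{-1}\mathbf 1},$$ where $\kappa=(1-c,c)\otimes\left(y^{m-1}\alpha+(1-y^{m-1})\alpha'\right)$, $\alpha'=\alpha(\delta I-S)^{-1}/\big(\alpha(\delta I-S)^{-1}\mathbf 1\big)$ and $$K=\begin{pmatrix}S-\delta cI&\delta cI\\ s^*\alpha&S\end{pmatrix}.$$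
   Context: Job sizes have a phase-type (PH) distribution $(\alpha,S)$: $\alpha$ is a probability row vector of length $n_s$, $S$ an invertible $n_s\times n_s$ subgenerator matrix, $s^*=-S\mathbf 1$ ($\mathbf 1$ an all-ones column of appropriate length), and the mean is $\alpha(-S)^{-1}\mathbf 1=1$. Water filling chain: for an integer $m\ge0$ and $c\in[0,1]$, consider the continuous-time Markov chain on the states $0$ and $(q,j)$, $1\le q\le m+1$, $1\le j\le n_s$ ($q$ = queue length, $j$ = service phase), with transitions: (i) $(q,j)\to(q,j')$ at rate $S_{jj'}$, $j\ne j'$; (ii) $(q,j)\to(q-1,j')$ at rate $s_j^*\alpha_{j'}$ if $q\ge2$, and $(1,j)\to0$ at rate $s^*_j$; (iii) from $(q,j)$ with $1\le q\le m$: to $(m+1,j)$ at rate $\delta c$, and, if $q<m$, to $(m,j)$ at rate $\delta(1-c)$; (iv) from $0$: to $(m+1,j)$ at rate $\delta c\,\alpha_j$, and, if $m\ge1$, to $(m,j)$ at rate $\delta(1-c)\alpha_j$. Let $\pi_0(m,c)$ be the stationary probability of state $0$. The queue at the cavity of the water filling policy with arrival rate $\lambda$ is the stationary version of this chain for the unique pair $(m,c)$, $m\in\{0,1,\dots\}$, $c\in[0,1)$, such that $\pi_0(m,c)=1-\lambda$. *)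

theory Defs
  imports "HOL-Analysis.Analysis" "HOL-Probability.Probability_Mass_Function"
begin

section \<open>Phase-type distributions\<close>

text \<open>
  The number of phases is the cardinality of the index type. The vector \<open>1\<close> of type
  \<open>real ^ 'n\<close> is the all-ones vector, \<open>mat d\<close> is \<open>d\<close> times the identity matrix, and the
  product of a row vector with a column vector is written as an inner product.
\<close>

definition prob_vector :: "real ^ 'n \<Rightarrow> bool" where
  "prob_vector \<alpha> \<longleftrightarrow> (\<forall>i. 0 \<le> \<alpha> $ i) \<and> (\<Sum>i\<in>UNIV. \<alpha> $ i) = 1"

definition subgenerator :: "real ^ 'n ^ 'n \<Rightarrow> bool" where
  "subgenerator S \<longleftrightarrow>
     (\<forall>i j. i \<noteq> j \<longrightarrow> 0 \<le> S $ i $ j) \<and> (\<forall>i. (\<Sum>j\<in>UNIV. S $ i $ j) \<le> 0)"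

definition phase_type :: "real ^ 'n \<Rightarrow> real ^ 'n ^ 'n \<Rightarrow> bool" where
  "phase_type \<alpha> S \<longleftrightarrow> prob_vector \<alpha> \<and> subgenerator S \<and> invertible S"

definition exit_rates :: "real ^ 'n ^ 'n \<Rightarrow> real ^ 'n" where
  "exit_rates S = - (S *v 1)"

definition ph_mean :: "real ^ 'n \<Rightarrow> real ^ 'n ^ 'n \<Rightarrow> real" where
  "ph_mean \<alpha> S = \<alpha> \<bullet> (matrix_inv (- S) *v 1)"

section \<open>Stationary distribution of a finite continuous-time Markov chain\<close>

text \<open>
  Global balance equations on the finite state set \<open>X\<close>, where \<open>r x y\<close> is the transition rate
  from \<open>x\<close> to \<open>y\<close>; only the rates between distinct states matter.
\<close>

definition stationary_distribution :: "'s set \<Rightarrow> ('s \<Rightarrow> 's \<Rightarrow> real) \<Rightarrow> 's pmf \<Rightarrow> bool" where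
  "stationary_distribution X r \<pi> \<longleftrightarrow> set_pmf \<pi> \<subseteq> X \<and>
     (\<forall>y\<in>X. (\<Sum>x\<in>X - {y}. pmf \<pi> x * r x y) = pmf \<pi> y * (\<Sum>z\<in>X - {y}. r y z))"

section \<open>The water filling chain\<close>

datatype 'n state = Idle | Busy nat 'n

definition wf_states :: "nat \<Rightarrow> 'n state set" where
  "wf_states m = insert Idle {Busy q j |q j. 1 \<le> q \<and> q \<le> m + 1}"

fun wf_rate ::
  "real \<Rightarrow> real ^ 'n \<Rightarrow> real ^ 'n ^ 'n \<Rightarrow> nat \<Rightarrow> real \<Rightarrow> 'n state \<Rightarrow> 'n state \<Rightarrow> real" where
  "wf_rate \<delta> \<alpha> S m c (Busy q j) (Busy q' j') =
     (if q' = q \<and> j' \<noteq> j then S $ j $ j' else 0)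
   + (if q \<ge> 2 \<and> q' = q - 1 then exit_rates S $ j * \<alpha> $ j' else 0)
   + (if q \<le> m \<and> q' = m + 1 \<and> j' = j then \<delta> * c else 0)
   + (if q < m \<and> q' = m \<and> j' = j then \<delta> * (1 - c) else 0)"
| "wf_rate \<delta> \<alpha> S m c (Busy q j) Idle = (if q = 1 then exit_rates S $ j else 0)"
| "wf_rate \<delta> \<alpha> S m c Idle (Busy q j) =
     (if q = m + 1 then \<delta> * c * \<alpha> $ j else 0)
   + (if m \<ge> 1 \<and> q = m then \<delta> * (1 - c) * \<alpha> $ j else 0)"
| "wf_rate \<delta> \<alpha> S m c Idle Idle = 0"

definition wf_stationary ::
  "real \<Rightarrow> real ^ 'n \<Rightarrow> real ^ 'n ^ 'n \<Rightarrow> nat \<Rightarrow> real \<Rightarrow> 'n state pmf" where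
  "wf_stationary \<delta> \<alpha> S m c =
     (THE \<pi>. stationary_distribution (wf_states m) (wf_rate \<delta> \<alpha> S m c) \<pi>)"

definition wf_idle_prob ::
  "real \<Rightarrow> real ^ 'n \<Rightarrow> real ^ 'n ^ 'n \<Rightarrow> nat \<Rightarrow> real \<Rightarrow> real" where
  "wf_idle_prob \<delta> \<alpha> S m c = pmf (wf_stationary \<delta> \<alpha> S m c) Idle"

text \<open>
  The parameters of the queue at the cavity of the water filling policy with arrival rate
  \<open>lam\<close> and probe rate \<open>\<delta>\<close>; the queue itself is the stationary chain with these parameters.
\<close>

definition wf_cavity_params ::
  "real \<Rightarrow> real \<Rightarrow> real ^ 'n \<Rightarrow> real ^ 'n ^ 'n \<Rightarrow> nat \<times> real" where
  "wf_cavity_params lam \<delta> \<alpha> S =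
     (THE (m, c). c \<in> {0..<1} \<and> wf_idle_prob \<delta> \<alpha> S m c = 1 - lam)"

section \<open>The quantities in the closed formula\<close>

definition no_probe_prob :: "real \<Rightarrow> real ^ 'n \<Rightarrow> real ^ 'n ^ 'n \<Rightarrow> real" where
  "no_probe_prob \<delta> \<alpha> S = \<alpha> \<bullet> (matrix_inv (mat \<delta> - S) *v exit_rates S)"

definition probe_phase :: "real \<Rightarrow> real ^ 'n \<Rightarrow> real ^ 'n ^ 'n \<Rightarrow> real ^ 'n" where
  "probe_phase \<delta> \<alpha> S =
     (1 / (\<alpha> \<bullet> (matrix_inv (mat \<delta> - S) *v 1))) *\<^sub>R (\<alpha> v* matrix_inv (mat \<delta> - S))"

definition block_vec :: "real ^ 'n \<Rightarrow> real ^ 'n \<Rightarrow> real ^ ('n + 'n)" where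
  "block_vec u v = (\<chi> i. case i of Inl a \<Rightarrow> u $ a | Inr b \<Rightarrow> v $ b)"

definition block_mat ::
  "real ^ 'n ^ 'n \<Rightarrow> real ^ 'n ^ 'n \<Rightarrow> real ^ 'n ^ 'n \<Rightarrow> real ^ 'n ^ 'n
   \<Rightarrow> real ^ ('n + 'n) ^ ('n + 'n)" where
  "block_mat A B C D =
     (\<chi> i. case i of Inl a \<Rightarrow> block_vec (A $ a) (B $ a) | Inr b \<Rightarrow> block_vec (C $ b) (D $ b))"

text \<open>
  In \<open>wf_kappa\<close> the Kronecker product of \<open>(1 - c, c)\<close> with a row vector is written as a block
  vector, and \<open>y\<close> has an integer exponent because \<open>m - 1\<close> is \<open>-1\<close> for \<open>m = 0\<close>.
\<close>

definition wf_kappa ::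
  "real \<Rightarrow> real ^ 'n \<Rightarrow> real ^ 'n ^ 'n \<Rightarrow> nat \<Rightarrow> real \<Rightarrow> real ^ ('n + 'n)" where
  "wf_kappa \<delta> \<alpha> S m c =
     (let p = no_probe_prob \<delta> \<alpha> S powi (int m - 1);
          \<beta> = p *\<^sub>R \<alpha> + (1 - p) *\<^sub>R probe_phase \<delta> \<alpha> S
      in block_vec ((1 - c) *\<^sub>R \<beta>) (c *\<^sub>R \<beta>))"

definition wf_K ::
  "real \<Rightarrow> real ^ 'n \<Rightarrow> real ^ 'n ^ 'n \<Rightarrow> real \<Rightarrow> real ^ ('n + 'n) ^ ('n + 'n)" where
  "wf_K \<delta> \<alpha> S c =
     block_mat (S - mat (\<delta> * c)) (mat (\<delta> * c)) (\<chi> i j. exit_rates S $ i * \<alpha> $ j) S"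

end

theory Submission
  imports Defs
begin

text \<open>
  Cut equations between consecutive queue lengths determine the stationary vector up to a factor:
  below level \<open>m\<close> the level vectors are multiples of \<open>\<alpha> (\<delta> I - S)\<inverse>\<close> growing by the factor
  \<open>1 / y\<close>, and at levels \<open>m\<close> and \<open>m + 1\<close> they are obtained from the resolvent of \<open>S\<close> at \<open>\<delta> c\<close>
  and at \<open>0\<close>. With \<open>y(d) = \<alpha> (d I - S)\<inverse> s\<^sup>*\<close> the normalisation gives
  \<open>1 / \<pi>\<^sub>0(m, c) = 1 + \<delta> c + \<delta> (1 + y\<^sup>-\<^sup>1 + \<dots> + y\<^sup>1\<^sup>-\<^sup>m) / y(\<delta> c)\<close>. Solving the block system for \<open>(-K)\<inverse> 1\<close>
  turns the closed formula into the same expression, also for \<open>m = 0\<close>. It increases strictly and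
  continuously from \<open>(m, 0)\<close> to \<open>(m + 1, 0)\<close>, so \<open>m\<close> is found by comparing geometric sums.
\<close>

section \<open>Resolvents of subgenerators\<close>

lemma mat_mult_vec: "mat d *v x = d *\<^sub>R x" for x :: "real ^ 'n"
  by (simp add: vec_eq_iff matrix_vector_mult_def mat_def if_distrib[of "\<lambda>z. z * _"] cong: if_cong)

lemma vec_mult_mat: "x v* mat d = d *\<^sub>R x" for x :: "real ^ 'n"
  by (simp add: vec_eq_iff vector_matrix_mult_def mat_def if_distrib[of "\<lambda>z. _ * z"] cong: if_cong)

lemma invertibleI_ker:
  fixes A :: "real ^ 'n ^ 'n"
  assumes "\<And>x. A *v x = 0 \<Longrightarrow> x = 0"
  shows "invertible A"
  using assms by (simp add: invertible_left_inverse matrix_left_invertible_ker)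

lemma matrix_inv_mult_vec:
  fixes A :: "real ^ 'n ^ 'n"
  assumes "invertible A"
  shows "A *v (matrix_inv A *v b) = b" "matrix_inv A *v (A *v x) = x"
    "(b v* matrix_inv A) v* A = b" "(x v* A) v* matrix_inv A = x"
proof -
  have "A ** matrix_inv A = mat 1 \<and> matrix_inv A ** A = mat 1"
    unfolding matrix_inv_def using assms unfolding invertible_def by (rule someI_ex)
  then show "A *v (matrix_inv A *v b) = b" "matrix_inv A *v (A *v x) = x"
    "(b v* matrix_inv A) v* A = b" "(x v* A) v* matrix_inv A = x"
    by (simp_all add: matrix_vector_mul_assoc vector_matrix_mul_assoc)
qed

lemma inner_nonneg:
  fixes u v :: "real ^ 'n"
  assumes "\<And>i. 0 \<le> u $ i" "\<And>i. 0 \<le> v $ i"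
  shows "0 \<le> u \<bullet> v"
  using assms by (auto simp: inner_vec_def intro!: sum_nonneg)

text \<open>If the minimum of \<open>x\<close>, attained at \<open>i0\<close>, were negative,
  writing each entry as this minimum plus a nonnegative excess would give
  \<open>(S *v x) $ i0 \<ge> 0\<close>: off-diagonal rates are nonnegative and the row sum is at
  most 0. Since \<open>d > 0\<close>, row \<open>i0\<close> of \<open>(mat d - S) *v x\<close> would
  be negative.\<close>

lemma subgenerator_min_principle:
  assumes S: "subgenerator S" and d: "d > 0"
    and nn: "\<And>i. 0 \<le> ((mat d - S) *v x) $ i"
  shows "0 \<le> x $ i"
proof -
  define i0 where "i0 = arg_min_on (($) x) UNIV"
  have mini: "x $ i0 \<le> x $ j" for j
    unfolding i0_def by (rule arg_min_least) auto
  have "0 \<le> x $ i0"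
  proof (rule ccontr)
    assume neg: "\<not> 0 \<le> x $ i0"
    have "(\<Sum>j\<in>UNIV. S $ i0 $ j * x $ j)
        = (\<Sum>j\<in>UNIV. S $ i0 $ j * (x $ j - x $ i0)) + x $ i0 * (\<Sum>j\<in>UNIV. S $ i0 $ j)"
      by (simp add: sum_distrib_left algebra_simps flip: sum.distrib)
    moreover have "0 \<le> (\<Sum>j\<in>UNIV. S $ i0 $ j * (x $ j - x $ i0))"
    proof (rule sum_nonneg)
      fix j
      show "0 \<le> S $ i0 $ j * (x $ j - x $ i0)"
        using S mini[of j] by (cases "j = i0") (auto simp: subgenerator_def)
    qed
    moreover have "0 \<le> x $ i0 * (\<Sum>j\<in>UNIV. S $ i0 $ j)"
      using S neg by (auto simp: subgenerator_def intro: mult_nonpos_nonpos)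
    moreover have "d * x $ i0 < 0"
      using neg d by (simp add: mult_pos_neg)
    ultimately have "((mat d - S) *v x) $ i0 < 0"
      unfolding matrix_vector_mult_diff_rdistrib mat_mult_vec
      by (simp add: matrix_vector_mult_def)
    with nn[of i0] show False by simp
  qed
  with mini[of i] show ?thesis by simp
qed

text \<open>For a phase-type distribution, entry (i, j) is the expected time spent in phase j from
  phase i before completion or before an independent exponential clock of rate \<open>d\<close>
  rings.\<close>

definition resolvent :: "real ^ 'n ^ 'n \<Rightarrow> real \<Rightarrow> real ^ 'n ^ 'n" where
  "resolvent S d = matrix_inv (mat d - S)"

locale phase_type_dist =
  fixes \<alpha> :: "real ^ 'n" and S :: "real ^ 'n ^ 'n"
  assumes phase_type: "phase_type \<alpha> S"
begin

abbreviation "R \<equiv> resolvent S"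
abbreviation "s \<equiv> exit_rates S"
text \<open>The Laplace transform of the job size, needed as a function of \<open>d\<close> because
  the chain involves it at \<delta> c as well as at \<delta>.\<close>

abbreviation "y d \<equiv> no_probe_prob d \<alpha> S"

lemma
  shows \<alpha>_nonneg: "0 \<le> \<alpha> $ i" and \<alpha>_one: "\<alpha> \<bullet> 1 = 1" and subgen: "subgenerator S"
    and inv_S: "invertible S"
  using phase_type by (auto simp: phase_type_def prob_vector_def inner_vec_def)

lemma inner_\<alpha>_pos:
  assumes "\<And>i. 0 < v $ i"
  shows "0 < \<alpha> \<bullet> v"
proof -
  have "\<exists>i. \<alpha> $ i \<noteq> 0"
    using \<alpha>_one by (rule contrapos_pp) (simp add: inner_vec_def)
  then obtain i where "\<alpha> $ i > 0"
    using \<alpha>_nonneg by (metis less_le)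
  with assms \<alpha>_nonneg show ?thesis
    by (auto simp: inner_vec_def intro!: sum_pos2[of _ i] mult_nonneg_nonneg less_imp_le[OF assms])
qed

lemma exit_rates_nonneg: "0 \<le> s $ i"
  using subgen by (simp add: exit_rates_def subgenerator_def matrix_vector_mult_def)

text \<open>For \<open>d > 0\<close> the minimum principle applies to a kernel vector and to its
  negative, so the vector is 0; for \<open>d = 0\<close> the invertibility of \<open>S\<close> is
  part of \<open>phase_type\<close>.\<close>

lemma invertible_shift:
  assumes "0 \<le> d"
  shows "invertible (mat d - S)"
proof (rule invertibleI_ker)
  fix x :: "real ^ 'n"
  assume 0: "(mat d - S) *v x = 0"
  show "x = 0"
  proof (cases "d = 0")
    case True
    with 0 have "- (S *v x) = 0"
      by (simp only: matrix_vector_mult_diff_rdistrib mat_mult_vec) simp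
    then have "S *v x = 0"
      by (simp only: neg_equal_0_iff_equal)
    then show ?thesis
      using matrix_inv_mult_vec(2)[OF inv_S, of x] by simp
  next
    case False
    have neg: "(mat d - S) *v (- x) = 0"
      using 0 matrix_vector_mult_scaleR[of "mat d - S" "-1" x] by simp
    have "0 \<le> (- x) $ i" for i
      by (rule subgenerator_min_principle[OF subgen, of d]) (use False assms neg in simp_all)
    moreover have "0 \<le> x $ i" for i
      by (rule subgenerator_min_principle[OF subgen, of d]) (use False assms 0 in simp_all)
    ultimately show ?thesis
      by (simp add: vec_eq_iff order_antisym)
  qed
qed

section \<open>Resolvent equations, continuity and nonnegativity\<close>

lemma resolvent_mult:
  assumes "0 \<le> d"
  shows "(mat d - S) *v (R d *v b) = b" "R d *v ((mat d - S) *v x) = x"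
    "(b v* R d) v* (mat d - S) = b" "(x v* (mat d - S)) v* R d = x"
  using matrix_inv_mult_vec[OF invertible_shift[OF assms]] by (auto simp: resolvent_def)

text \<open>With this, later resolvent identities reduce to checking one linear equation instead of
  manipulating inverse matrices.\<close>

lemma resolvent_unique: "0 \<le> d \<Longrightarrow> d *\<^sub>R x - S *v x = b \<Longrightarrow> R d *v b = x"
  using resolvent_mult(2)[of d x] by (simp add: matrix_vector_mult_diff_rdistrib mat_mult_vec)

lemma resolvent_unique_left: "0 \<le> d \<Longrightarrow> d *\<^sub>R x - x v* S = b \<Longrightarrow> b v* R d = x"
  using resolvent_mult(4)[of d x] by (simp add: vector_matrix_mult_diff_rdistrib vec_mult_mat)

lemma S_resolvent: "0 \<le> d \<Longrightarrow> S *v (R d *v b) = d *\<^sub>R (R d *v b) - b"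
  using resolvent_mult(1)[of d b]
  by (simp add: matrix_vector_mult_diff_rdistrib mat_mult_vec algebra_simps)

lemma resolvent_S: "0 \<le> d \<Longrightarrow> (b v* R d) v* S = d *\<^sub>R (b v* R d) - b"
  using resolvent_mult(3)[of d b]
  by (simp add: vector_matrix_mult_diff_rdistrib vec_mult_mat algebra_simps)

text \<open>By Cramer's rule each coordinate is a quotient of determinants whose entries are
  continuous in \<open>d\<close>, and the denominator does not vanish.\<close>

lemma continuous_on_resolvent: "continuous_on {0..} (\<lambda>d. R d *v b)"
proof (subst continuous_on_componentwise)
  have nz: "det (mat d - S) \<noteq> 0" if "0 \<le> d" for d
    using invertible_shift[OF that] invertible_det_nz by blast
  have "R d *v b = (\<chi> k. det (\<chi> i j. if j = k then b $ i else (mat d - S) $ i $ j) / det (mat d - S))"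
    if "0 \<le> d" for d
    using cramer[OF nz[OF that], of "R d *v b" b] resolvent_mult(1)[OF that] by blast
  then have eq: "(R d *v b) \<bullet> axis k 1
      = det (\<chi> i j. if j = k then b $ i else (mat d - S) $ i $ j) / det (mat d - S)"
    if "0 \<le> d" for d k
    using that by (simp add: inner_axis)
  have cont: "continuous_on {0..} (\<lambda>d. det (A d))"
    if "\<And>i j. continuous_on {0..} (\<lambda>d. A d $ i $ j)" for A :: "real \<Rightarrow> real ^ 'n ^ 'n"
    unfolding det_def by (intro continuous_intros that)
  have entry: "continuous_on {0..} (\<lambda>d. (mat d - S) $ i $ j)" for i j
    by (cases "i = j") (auto simp: mat_def intro!: continuous_intros)
  have "continuous_on {0..} (\<lambda>d. (R d *v b) \<bullet> axis k 1)" for k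
  proof (subst continuous_on_cong[OF refl eq])
    show "continuous_on {0..} (\<lambda>d. det (\<chi> i j. if j = k then b $ i else (mat d - S) $ i $ j) / det (mat d - S))"
    proof (intro continuous_on_divide cont ballI)
      show "continuous_on {0..} (\<lambda>d. (\<chi> i j. if j = k then b $ i else (mat d - S) $ i $ j) $ i $ j)" for i j
        using entry[of i j] by (cases "j = k") auto
    qed (use entry nz in auto)
  qed auto
  then show "\<forall>i\<in>Basis. continuous_on {0..} (\<lambda>d. (R d *v b) \<bullet> i)"
    by (auto simp: Basis_vec_def)
qed

text \<open>The minimum principle needs \<open>d > 0\<close>; the case \<open>d = 0\<close> is reached as a limit.\<close>

lemma resolvent_nonneg:
  assumes d: "0 \<le> d" and b: "\<And>i. 0 \<le> b $ i"
  shows "0 \<le> (R d *v b) $ i"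
proof -
  have pos: "0 \<le> (R e *v b) $ i" if "0 < e" for e
    by (rule subgenerator_min_principle[OF subgen that]) (use that b in \<open>simp_all add: resolvent_mult\<close>)
  show ?thesis
  proof (cases "d = 0")
    case True
    have "((\<lambda>e. (R e *v b) $ i) \<longlongrightarrow> (R 0 *v b) $ i) (at_right 0)"
    proof (rule tendsto_vec_nth)
      have "((\<lambda>e. R e *v b) \<longlongrightarrow> R 0 *v b) (at 0 within {0..})"
        using continuous_on_resolvent by (simp add: continuous_on)
      then show "((\<lambda>e. R e *v b) \<longlongrightarrow> R 0 *v b) (at_right 0)"
        by (rule tendsto_within_subset) auto
    qed
    moreover have "eventually (\<lambda>e. 0 \<le> (R e *v b) $ i) (at_right 0)"
      using pos by (auto simp: eventually_at_filter)
    ultimately show ?thesis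
      using True by (auto intro: tendsto_lowerbound)
  qed (use d pos in auto)
qed

lemma resolvent_nonneg_left:
  assumes d: "0 \<le> d" and b: "\<And>i. 0 \<le> b $ i"
  shows "0 \<le> (b v* R d) $ i"
proof -
  have "(b v* R d) $ i = (b v* R d) \<bullet> axis i 1"
    by (simp add: inner_axis)
  also have "\<dots> = b \<bullet> (R d *v axis i 1)"
    by (rule dot_lmul_matrix)
  also have "\<dots> \<ge> 0"
    by (intro inner_nonneg b resolvent_nonneg d) (auto simp: axis_def)
  finally show ?thesis .
qed

section \<open>The transform \<open>y d\<close>: bounds, monotonicity and positivity\<close>

lemma no_probe_prob_eq: "y d = \<alpha> \<bullet> (R d *v s)"
  by (simp add: no_probe_prob_def resolvent_def)

lemma S_one: "S *v 1 = - s"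
  by (simp add: exit_rates_def)

lemma resolvent_exit: "0 \<le> d \<Longrightarrow> R d *v s = 1 - d *\<^sub>R (R d *v 1)"
  by (rule resolvent_unique)
     (auto simp: matrix_vector_mult_diff_distrib matrix_vector_mult_scaleR S_resolvent S_one algebra_simps)

lemma no_probe_prob_resolvent: "0 \<le> d \<Longrightarrow> y d = 1 - d * (\<alpha> \<bullet> (R d *v 1))"
  by (simp add: no_probe_prob_eq resolvent_exit inner_diff_right \<alpha>_one)

lemma no_probe_prob_0 [simp]: "y 0 = 1"
  by (simp add: no_probe_prob_resolvent)

text \<open>The first resolvent identity; it links the rates 0, \<delta> c and \<delta> that occur
  in the chain.\<close>

lemma resolvent_identity:
  assumes "0 \<le> d" "0 \<le> e"
  shows "(d - e) *\<^sub>R (R d *v (R e *v b)) = R e *v b - R d *v b"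
  unfolding matrix_vector_mult_scaleR[symmetric]
  by (rule resolvent_unique)
     (use assms in \<open>auto simp: matrix_vector_mult_diff_distrib S_resolvent algebra_simps\<close>)

text \<open>If the nonnegative vector \<open>R d *v 1\<close> vanished at \<open>i\<close>, row
  \<open>i\<close> of \<open>S\<close> applied to it would be a sum of nonnegative terms, whereas
  \<open>S_resolvent\<close> gives it the value -1.\<close>

lemma resolvent_one_pos:
  assumes "0 \<le> d"
  shows "0 < (R d *v 1) $ i"
proof (rule ccontr)
  assume "\<not> ?thesis"
  with resolvent_nonneg[OF assms, of 1 i] have z: "(R d *v 1) $ i = 0"
    by simp
  have "0 \<le> S $ i $ j * (R d *v 1) $ j" for j
    using subgen z resolvent_nonneg[OF assms, of 1 j] by (cases "j = i") (auto simp: subgenerator_def)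
  then have "0 \<le> (S *v (R d *v 1)) $ i"
    unfolding matrix_vector_mult_def[of S] by (auto intro: sum_nonneg)
  then show False
    using z by (simp add: S_resolvent[OF assms])
qed

lemma no_probe_prob_le_1: "0 \<le> d \<Longrightarrow> y d \<le> 1"
  by (simp add: no_probe_prob_resolvent inner_nonneg \<alpha>_nonneg resolvent_nonneg)

lemma no_probe_prob_less_1: "0 < d \<Longrightarrow> y d < 1"
  using inner_\<alpha>_pos[OF resolvent_one_pos[of d]] by (simp add: no_probe_prob_resolvent)

text \<open>The resolvent identity writes \<open>y d - y e\<close> as \<open>e - d\<close> times a
  product of nonnegative factors.\<close>

lemma no_probe_prob_antimono:
  assumes "0 \<le> d" "d \<le> e"
  shows "y e \<le> y d"
proof -
  have "0 \<le> (e - d) * (\<alpha> \<bullet> (R d *v (R e *v s)))"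
    using assms by (auto intro!: mult_nonneg_nonneg inner_nonneg \<alpha>_nonneg resolvent_nonneg exit_rates_nonneg)
  also have "\<dots> = \<alpha> \<bullet> ((e - d) *\<^sub>R (R d *v (R e *v s)))"
    by simp
  also have "(e - d) *\<^sub>R (R d *v (R e *v s)) = R d *v s - R e *v s"
    using resolvent_identity[of d e s] assms by (simp add: algebra_simps)
  finally show ?thesis
    by (simp add: no_probe_prob_eq inner_diff_right)
qed

text \<open>
  The phases from which no service completion is reachable form a set \<open>Z\<close> whose indicator \<open>u\<close>
  satisfies \<open>-S u \<le> 0\<close>; since \<open>(-S)\<inverse>\<close> is nonnegative, \<open>Z\<close> is empty.
\<close>

lemma resolvent_exit_pos:
  assumes d: "0 \<le> d"
  shows "0 < (R d *v s) $ i"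
proof (rule ccontr)
  assume neg: "\<not> ?thesis"
  define z where "z = R d *v s"
  have z_nn: "0 \<le> z $ j" for j
    unfolding z_def by (intro resolvent_nonneg d exit_rates_nonneg)
  have zi: "z $ i = 0"
    using neg z_nn[of i] by (simp add: z_def)
  define u :: "real ^ 'n" where "u = (\<chi> j. if z $ j = 0 then 1 else 0)"
  have term_nn: "0 \<le> S $ k $ j * z $ j" if "z $ k = 0" for k j
    using subgen z_nn[of j] that by (cases "j = k") (auto simp: subgenerator_def)
  have Su: "0 \<le> (S *v u) $ k" for k
  proof (cases "z $ k = 0")
    case True
    \<comment> \<open>Where \<open>z\<close> vanishes, its equation makes a sum of nonnegative terms
      equal to \<open>- s $ k \<le> 0\<close>. Hence both are 0: phase \<open>k\<close> has no
      completions, and its positive rates lead only to zeros of \<open>z\<close>.\<close>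
    have "(\<Sum>j\<in>UNIV. S $ k $ j * z $ j) = - s $ k"
      using S_resolvent[OF d, of s] True
      by (simp add: vec_eq_iff matrix_vector_mult_def[of S] flip: z_def)
    then have "(\<Sum>j\<in>UNIV. S $ k $ j * z $ j) = 0" and sk: "s $ k = 0"
      using sum_nonneg[of UNIV "\<lambda>j. S $ k $ j * z $ j"] term_nn[OF True] exit_rates_nonneg[of k]
      by auto
    then have "S $ k $ j * z $ j = 0" for j
      using term_nn[OF True] by (subst (asm) sum_nonneg_eq_0_iff) auto
    then have "S $ k $ j * u $ j = S $ k $ j" for j
      by (auto simp: u_def)
    then have "(S *v u) $ k = (S *v 1) $ k"
      by (simp only: matrix_vector_mult_def vec_lambda_beta one_index mult_1_right)
    then show ?thesis
      using sk by (simp add: S_one)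
  next
    case False
    then have "0 \<le> S $ k $ j * u $ j" for j
      using subgen by (cases "j = k") (auto simp: subgenerator_def u_def)
    then show ?thesis
      unfolding matrix_vector_mult_def by (auto intro: sum_nonneg)
  qed
  have "0 \<le> (R 0 *v (S *v u)) $ i"
    by (intro resolvent_nonneg Su) simp
  moreover have "R 0 *v (S *v u) = - u"
    by (rule resolvent_unique) (use matrix_vector_mult_scaleR[of S "-1" u] in auto)
  ultimately show False
    by (simp add: u_def zi)
qed

lemma no_probe_prob_pos: "0 \<le> d \<Longrightarrow> 0 < y d"
  unfolding no_probe_prob_eq by (intro inner_\<alpha>_pos resolvent_exit_pos)

lemma continuous_on_no_probe_prob: "continuous_on {0..} y"
  unfolding no_probe_prob_eq by (intro continuous_intros continuous_on_resolvent)

end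

section \<open>The closed formula\<close>

lemma uminus_mult_vec: "(- A) *v x = - (A *v x)" for A :: "real ^ 'n ^ 'm"
  by (simp add: vec_eq_iff matrix_vector_mult_def sum_negf)

lemma outer_product_mult_vec: "(\<chi> i j. u $ i * v $ j) *v x = (v \<bullet> x) *\<^sub>R u"
  for u :: "real ^ 'm" and v x :: "real ^ 'n"
  by (simp add: vec_eq_iff matrix_vector_mult_def inner_vec_def sum_distrib_left algebra_simps)

lemma sum_UNIV_sum: "sum f (UNIV :: ('a::finite + 'b::finite) set) = (\<Sum>a\<in>UNIV. f (Inl a)) + (\<Sum>b\<in>UNIV. f (Inr b))"
  for f :: "_ \<Rightarrow> 'c::comm_monoid_add"
  by (simp add: sum.Plus flip: UNIV_Plus_UNIV)

lemma inner_block_vec: "block_vec u v \<bullet> block_vec u' v' = u \<bullet> u' + v \<bullet> v'"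
  by (simp add: inner_vec_def block_vec_def sum_UNIV_sum)

lemma block_vec_eq_iff: "block_vec u v = block_vec u' v' \<longleftrightarrow> u = u' \<and> v = v'"
  by (auto simp: vec_eq_iff block_vec_def split: sum.splits)

lemma block_vec_cases:
  obtains u v where "x = block_vec u v"
proof
  show "x = block_vec (\<chi> a. x $ Inl a) (\<chi> b. x $ Inr b)"
    by (auto simp: vec_eq_iff block_vec_def split: sum.splits)
qed

lemma block_vec_0: "block_vec 0 0 = 0" and block_vec_1: "block_vec 1 1 = 1"
  and block_vec_uminus: "- block_vec u v = block_vec (- u) (- v)"
  by (auto simp: vec_eq_iff block_vec_def split: sum.splits)

lemma block_mat_mult_block_vec:
  "block_mat A B C D *v block_vec u v = block_vec (A *v u + B *v v) (C *v u + D *v v)"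
  by (auto simp: vec_eq_iff block_vec_def block_mat_def matrix_vector_mult_def sum_UNIV_sum
      split: sum.splits)

section \<open>Scalar quantities of the chain and the block system for \<open>wf_K\<close>\<close>

locale water_filling = phase_type_dist +
  fixes \<delta> :: real
  assumes \<delta>_pos: "0 < \<delta>" and mean: "ph_mean \<alpha> S = 1"
begin

abbreviation "\<eta> \<equiv> y \<delta>"
text \<open>The direction of \<open>probe_phase\<close> before normalisation; all levels strictly
  between 0 and \<open>m\<close> are multiples of it.\<close>

abbreviation "u \<equiv> \<alpha> v* R \<delta>"

text \<open>At \<open>c = 0\<close> the odds of busy against idle are \<delta> times this geometric
  sum.\<close>

definition idle_odds :: "nat \<Rightarrow> real" where
  "idle_odds m = (\<Sum>k<m. (1 / \<eta>) ^ k)"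

text \<open>The reciprocal of the idle probability, as \<open>wf_idle_prob_eq\<close> confirms;
  equivalently the total mass when state 0 has weight 1.\<close>

definition idle_inv :: "nat \<Rightarrow> real \<Rightarrow> real" where
  "idle_inv m c = 1 + \<delta> * c + \<delta> * idle_odds m / y (\<delta> * c)"

lemma \<eta>_pos: "0 < \<eta>" and \<eta>_less_1: "\<eta> < 1"
  using no_probe_prob_pos no_probe_prob_less_1 \<delta>_pos by auto

lemma \<delta>_nonneg: "0 \<le> \<delta>"
  using \<delta>_pos by simp

lemma resolvent_0_exit: "R 0 *v s = 1"
  by (simp add: resolvent_exit)

lemma mean_resolvent: "\<alpha> \<bullet> (R 0 *v 1) = 1"
proof -
  have "mat 0 - S = - S"
    by (simp add: vec_eq_iff mat_def)
  with mean show ?thesis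
    by (simp add: ph_mean_def resolvent_def)
qed

lemma u_one: "u \<bullet> 1 = (1 - \<eta>) / \<delta>"
  using \<delta>_pos by (simp add: dot_lmul_matrix no_probe_prob_resolvent)

lemma u_exit: "u \<bullet> s = \<eta>"
  by (simp add: dot_lmul_matrix no_probe_prob_eq)

text \<open>Apply the resolvent identity at the rates \<delta> and 0 to the vector 1; the mean 1
  evaluates the term that contains only \<open>R 0\<close>.\<close>

lemma u_mean: "u \<bullet> (R 0 *v 1) = (1 - (1 - \<eta>) / \<delta>) / \<delta>"
proof -
  have "\<delta> * (u \<bullet> (R 0 *v 1)) = \<alpha> \<bullet> (\<delta> *\<^sub>R (R \<delta> *v (R 0 *v 1)))"
    by (simp add: dot_lmul_matrix)
  also have "\<dots> = 1 - u \<bullet> 1"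
    using resolvent_identity[of \<delta> 0 1] \<delta>_pos
    by (simp add: inner_diff_right mean_resolvent dot_lmul_matrix)
  finally show ?thesis
    using \<delta>_pos by (simp add: u_one field_simps)
qed

text \<open>The factor 1 - c is what the resolvent identity produces, since \<delta> (1 - c) is the
  difference of the rates \<delta> and \<delta> c. The product of two resolvents thereby collapses
  to values of \<open>y\<close>.\<close>

lemma u_resolvent_exit:
  assumes "0 \<le> c"
  shows "\<delta> * (1 - c) * (u \<bullet> (R (\<delta> * c) *v s)) = y (\<delta> * c) - \<eta>"
proof -
  have "\<delta> * (1 - c) * (u \<bullet> (R (\<delta> * c) *v s))
      = \<alpha> \<bullet> ((\<delta> - \<delta> * c) *\<^sub>R (R \<delta> *v (R (\<delta> * c) *v s)))"
    by (simp add: dot_lmul_matrix algebra_simps)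
  also have "\<dots> = y (\<delta> * c) - \<eta>"
    using resolvent_identity[of \<delta> "\<delta> * c" s] \<delta>_pos assms
    by (simp add: inner_diff_right no_probe_prob_eq)
  finally show ?thesis .
qed

lemma wf_K_mult:
  "wf_K \<delta> \<alpha> S c *v block_vec v w =
    block_vec (S *v v - (\<delta> * c) *\<^sub>R v + (\<delta> * c) *\<^sub>R w) ((\<alpha> \<bullet> v) *\<^sub>R s + S *v w)"
  unfolding wf_K_def block_mat_mult_block_vec outer_product_mult_vec
    matrix_vector_mult_diff_rdistrib mat_mult_vec by simp

text \<open>For a kernel vector with blocks \<open>v\<close> and \<open>w\<close>, the second block
  row forces \<open>w\<close> to be \<open>\<alpha> \<bullet> v\<close> times 1, and the first then
  expresses \<open>v\<close> through \<open>\<alpha> \<bullet> v\<close>. Pairing with \<alpha>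
  leaves \<open>(\<alpha> \<bullet> v) * y (\<delta> * c) = 0\<close>, and \<open>y\<close> is
  positive.\<close>

lemma invertible_wf_K:
  assumes c: "0 \<le> c"
  shows "invertible (- wf_K \<delta> \<alpha> S c)"
proof (rule invertibleI_ker)
  fix x
  assume "(- wf_K \<delta> \<alpha> S c) *v x = 0"
  moreover obtain v w where x: "x = block_vec v w"
    by (rule block_vec_cases)
  ultimately have "block_vec (S *v v - (\<delta> * c) *\<^sub>R v + (\<delta> * c) *\<^sub>R w) ((\<alpha> \<bullet> v) *\<^sub>R s + S *v w)
      = block_vec 0 0"
    by (simp add: uminus_mult_vec wf_K_mult block_vec_0)
  then have 1: "S *v v - (\<delta> * c) *\<^sub>R v + (\<delta> * c) *\<^sub>R w = 0"
    and 2: "(\<alpha> \<bullet> v) *\<^sub>R s + S *v w = 0"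
    by (auto simp: block_vec_eq_iff)
  have dc: "0 \<le> \<delta> * c"
    using \<delta>_pos c by simp
  have "R 0 *v ((\<alpha> \<bullet> v) *\<^sub>R s) = w"
    by (rule resolvent_unique) (use 2 in \<open>auto simp: add_eq_0_iff\<close>)
  then have w: "w = (\<alpha> \<bullet> v) *\<^sub>R 1"
    by (simp add: matrix_vector_mult_scaleR resolvent_0_exit)
  have "R (\<delta> * c) *v ((\<delta> * c) *\<^sub>R w) = v"
    by (rule resolvent_unique[OF dc]) (use 1 in \<open>auto simp: algebra_simps\<close>)
  then have v: "v = (\<alpha> \<bullet> v) *\<^sub>R (1 - R (\<delta> * c) *v s)"
    by (simp add: w matrix_vector_mult_scaleR resolvent_exit[OF dc] mult.commute)
  have "\<alpha> \<bullet> v = (\<alpha> \<bullet> v) * (1 - y (\<delta> * c))"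
    by (subst v) (simp add: inner_diff_right \<alpha>_one no_probe_prob_eq)
  then have "\<alpha> \<bullet> v = 0"
    using no_probe_prob_pos[OF dc] by (simp add: algebra_simps)
  then show "x = 0"
    using v w by (simp add: x block_vec_0)
qed

text \<open>The witness comes from block elimination: the second row gives
  \<open>w = R 0 *v 1 + (\<alpha> \<bullet> v) *\<^sub>R 1\<close>, substitution into the first row
  gives \<open>v\<close>, and pairing with \<alpha> gives
  \<open>\<alpha> \<bullet> v = 1 / y (\<delta> * c)\<close>.\<close>

lemma inv_wf_K_one:
  assumes c: "0 \<le> c"
  shows "matrix_inv (- wf_K \<delta> \<alpha> S c) *v 1 =
    block_vec (R 0 *v 1 + (1 / y (\<delta> * c)) *\<^sub>R (1 - R (\<delta> * c) *v s))
      (R 0 *v 1 + (1 / y (\<delta> * c)) *\<^sub>R 1)" (is "_ = block_vec ?v ?w")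
proof -
  have dc: "0 \<le> \<delta> * c"
    using \<delta>_pos c by simp
  note Y = no_probe_prob_pos[OF dc]
  have \<alpha>v: "\<alpha> \<bullet> ?v = 1 / y (\<delta> * c)"
    using Y by (simp add: inner_add_right inner_diff_right \<alpha>_one mean_resolvent
        flip: no_probe_prob_eq) (simp add: field_simps)
  have "S *v ?v - (\<delta> * c) *\<^sub>R ?v + (\<delta> * c) *\<^sub>R ?w = - 1"
    by (simp add: matrix_vector_right_distrib matrix_vector_mult_scaleR matrix_vector_mult_diff_distrib
        S_one S_resolvent dc scaleR_add_right scaleR_diff_right)
  moreover have "(\<alpha> \<bullet> ?v) *\<^sub>R s + S *v ?w = - 1"
    unfolding \<alpha>v by (simp add: matrix_vector_right_distrib matrix_vector_mult_scaleR S_one S_resolvent)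
  ultimately have "(- wf_K \<delta> \<alpha> S c) *v block_vec ?v ?w = 1"
    by (simp only: uminus_mult_vec wf_K_mult block_vec_uminus minus_minus block_vec_1)
  then show ?thesis
    using matrix_inv_mult_vec(2)[OF invertible_wf_K[OF c], of "block_vec ?v ?w"] by simp
qed

lemma idle_odds_eq: "idle_odds m = ((1 / \<eta>) ^ m - 1) / (1 / \<eta> - 1)"
  using \<eta>_less_1 \<eta>_pos unfolding idle_odds_def by (intro geometric_sum) simp

lemma idle_odds_Suc: "idle_odds (Suc m) = idle_odds m + (1 / \<eta>) ^ m"
  by (simp add: idle_odds_def)

lemma idle_odds_Suc': "idle_odds (Suc m) = 1 + idle_odds m / \<eta>"
  by (simp add: idle_odds_def sum.lessThan_Suc_shift sum_divide_distrib del: sum.lessThan_Suc)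

lemma idle_odds_nonneg: "0 \<le> idle_odds m"
  using \<eta>_pos by (auto simp: idle_odds_def intro!: sum_nonneg)

lemma idle_inv_pos:
  assumes "0 \<le> c"
  shows "0 < idle_inv m c"
  using assms \<delta>_pos no_probe_prob_pos[of "\<delta> * c"] idle_odds_nonneg[of m]
  unfolding idle_inv_def by (intro add_pos_nonneg divide_nonneg_nonneg mult_nonneg_nonneg) auto

text \<open>\<open>wf_kappa\<close> mixes the directions \<alpha> and \<open>u\<close>, so only
  their pairings with the two blocks of the solution matter. The denominator becomes
  \<open>p / \<delta> * idle_inv m c\<close>, and the numerator \<open>p / \<delta>\<close>
  cancels.\<close>

lemma closed_formula_eq:
  assumes c: "0 \<le> c" "c < 1"
  shows "(\<eta> powi (int m - 1) / \<delta>) /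
      (1 / \<delta> + wf_kappa \<delta> \<alpha> S m c \<bullet> (matrix_inv (- wf_K \<delta> \<alpha> S c) *v 1))
    = 1 / idle_inv m c"
proof -
  define p where "p = \<eta> powi (int m - 1)"
  define Y where "Y = y (\<delta> * c)"
  define k where "k = (1 - \<eta>) / \<delta>"
  define v where "v = R 0 *v 1 + (1 / Y) *\<^sub>R (1 - R (\<delta> * c) *v s)"
  define w where "w = R 0 *v 1 + (1 / Y) *\<^sub>R 1"
  have Y: "0 < Y"
    using no_probe_prob_pos \<delta>_pos c by (simp add: Y_def)
  have k: "0 < k" "k * \<delta> = 1 - \<eta>"
    using \<eta>_less_1 \<delta>_pos by (simp_all add: k_def)
  have p: "0 < p"
    using \<eta>_pos by (simp add: p_def)
  have \<alpha>: "\<alpha> \<bullet> v = 1 / Y" "\<alpha> \<bullet> w = 1 + 1 / Y"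
    using Y by (simp_all add: v_def w_def inner_add_right inner_diff_right \<alpha>_one mean_resolvent
        flip: no_probe_prob_eq Y_def) (simp add: field_simps)
  have uw: "u \<bullet> w = (1 - k) / \<delta> + k / Y"
    by (simp add: w_def inner_add_right u_mean u_one k_def)
  have uv: "u \<bullet> v = (1 - k) / \<delta> + k / Y - (u \<bullet> (R (\<delta> * c) *v s)) / Y"
    by (simp add: v_def inner_add_right inner_diff_right u_mean u_one k_def diff_divide_distrib)
  \<comment> \<open>The pairings \<open>u \<bullet> v\<close> and \<open>u \<bullet> w\<close>
    differ only in the term with \<open>R (\<delta> * c)\<close>. It carries the weight 1 - c here,
    exactly the form that \<open>u_resolvent_exit\<close> evaluates.\<close>
  have "(1 - c) * (u \<bullet> v) + c * (u \<bullet> w)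
      = (1 - k) / \<delta> + k / Y - (\<delta> * (1 - c) * (u \<bullet> (R (\<delta> * c) *v s))) / (\<delta> * Y)"
    using \<delta>_pos Y unfolding uv uw by (simp add: field_simps)
  also have "\<dots> = (1 - k) / \<delta> + k / Y - (Y - \<eta>) / (\<delta> * Y)"
    using c by (simp add: u_resolvent_exit Y_def)
  also have "\<dots> = - k / \<delta> + (k * \<delta> + \<eta>) / (\<delta> * Y)"
    using \<delta>_pos Y by (simp add: field_simps)
  also have "\<dots> = - k / \<delta> + 1 / (\<delta> * Y)"
    by (simp add: k)
  finally have mix_u: "(1 - c) * (u \<bullet> v) + c * (u \<bullet> w) = - k / \<delta> + 1 / (\<delta> * Y)" .
  have beta: "probe_phase \<delta> \<alpha> S = (1 / k) *\<^sub>R u"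
    using u_one by (simp add: probe_phase_def k_def dot_lmul_matrix resolvent_def)
  have "wf_kappa \<delta> \<alpha> S m c \<bullet> (matrix_inv (- wf_K \<delta> \<alpha> S c) *v 1)
      = p * ((1 - c) * (\<alpha> \<bullet> v) + c * (\<alpha> \<bullet> w))
        + (1 - p) / k * ((1 - c) * (u \<bullet> v) + c * (u \<bullet> w))"
    unfolding wf_kappa_def Let_def inv_wf_K_one[OF c(1)] inner_block_vec beta
      p_def[symmetric] Y_def[symmetric] v_def[symmetric] w_def[symmetric]
    by (simp add: inner_add_left distrib_left add_divide_distrib) (simp add: algebra_simps)
  also have "\<dots> = p * (1 / Y + c) + (1 - p) / k * (- k / \<delta> + 1 / (\<delta> * Y))"
    unfolding mix_u \<alpha> using Y by (simp add: field_simps)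
  also have "\<dots> = p * (1 / Y + c) - (1 - p) / \<delta> + (1 - p) / ((1 - \<eta>) * Y)"
    unfolding k(2)[symmetric] using k Y \<delta>_pos by (simp add: field_simps)
  finally have W: "wf_kappa \<delta> \<alpha> S m c \<bullet> (matrix_inv (- wf_K \<delta> \<alpha> S c) *v 1)
      = p * (1 / Y + c) - (1 - p) / \<delta> + (1 - p) / ((1 - \<eta>) * Y)" .
  have "(p * (1 - \<eta>) + (1 - p)) / ((1 - \<eta>) * Y) = p / Y + (1 - p) / ((1 - \<eta>) * Y)"
    using \<eta>_less_1 by (simp add: add_divide_distrib)
  then have kap: "1 / \<delta> + wf_kappa \<delta> \<alpha> S m c \<bullet> (matrix_inv (- wf_K \<delta> \<alpha> S c) *v 1)
      = p * (1 / \<delta> + c) + (p * (1 - \<eta>) + (1 - p)) / ((1 - \<eta>) * Y)"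
    unfolding W by (simp add: distrib_left diff_divide_distrib)
  \<comment> \<open>The integer exponent makes this valid for \<open>m = 0\<close> too, where
    \<open>p\<close> is \<open>1 / \<eta>\<close> and the mix in \<open>wf_kappa\<close> is not
    convex.\<close>
  have "p * \<eta> * (1 / \<eta>) ^ m = 1"
    using \<eta>_pos by (simp add: p_def power_int_diff power_divide)
  then have odds: "p * idle_odds m * (1 - \<eta>) = p * (1 - \<eta>) + (1 - p)"
    using \<eta>_less_1 \<eta>_pos p by (simp add: idle_odds_eq field_simps)
  have "(p * (1 - \<eta>) + (1 - p)) / ((1 - \<eta>) * Y) = p * idle_odds m / Y"
    unfolding odds[symmetric] using \<eta>_less_1 by simp
  then have "1 / \<delta> + wf_kappa \<delta> \<alpha> S m c \<bullet> (matrix_inv (- wf_K \<delta> \<alpha> S c) *v 1) = p / \<delta> * idle_inv m c"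
    unfolding kap idle_inv_def Y_def[symmetric] using \<delta>_pos by (simp add: field_simps)
  then show ?thesis
    using p \<delta>_pos by (simp flip: p_def)
qed

end

section \<open>Balance equations\<close>

lemma
  fixes g :: "'n::finite state \<Rightarrow> real"
  shows finite_wf_states: "finite (wf_states m :: 'n state set)"
    and sum_wf_states: "(\<Sum>x\<in>wf_states m. g x) = g Idle + (\<Sum>q=1..m+1. \<Sum>j\<in>UNIV. g (Busy q j))"
proof -
  have eq: "wf_states m = insert Idle ((\<lambda>(q, j). Busy q j) ` ({1..m+1} \<times> (UNIV :: 'n set)))"
    by (auto simp: wf_states_def)
  show "finite (wf_states m :: 'n state set)"
    unfolding eq by simp
  have "inj_on (\<lambda>(q, j). Busy q j) ({1..m+1} \<times> (UNIV :: 'n set))"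
    by (auto simp: inj_on_def)
  then show "(\<Sum>x\<in>wf_states m. g x) = g Idle + (\<Sum>q=1..m+1. \<Sum>j\<in>UNIV. g (Busy q j))"
    unfolding eq by (subst sum.insert) (auto simp: sum.reindex sum.cartesian_product split_def simp del: sum.cl_ivl_Suc)
qed

text \<open>Lets the sums in the balance equations, which omit one state, run over all
  states.\<close>

lemma wf_rate_diag: "wf_rate \<delta> \<alpha> S m c x x = 0"
  by (cases x) auto

lemma sum_remove_zero: "finite A \<Longrightarrow> f y = 0 \<Longrightarrow> (\<Sum>x\<in>A - {y}. f x) = (\<Sum>x\<in>A. f x)"
  for f :: "'a \<Rightarrow> real"
  by (cases "y \<in> A") (auto simp: sum_diff1)

definition level :: "('n::finite state \<Rightarrow> real) \<Rightarrow> nat \<Rightarrow> real ^ 'n" where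
  "level f q = (\<chi> j. f (Busy q j))"

section \<open>Flow into and out of each state\<close>

context water_filling
begin

abbreviation "rate \<equiv> wf_rate \<delta> \<alpha> S"

lemma sum_\<alpha>: "(\<Sum>j\<in>UNIV. \<alpha> $ j) = 1"
  using \<alpha>_one by (simp add: inner_vec_def)

lemma inflow_Idle: "(\<Sum>x\<in>wf_states m. f x * rate m c x Idle) = level f 1 \<bullet> s"
proof -
  have inner: "(\<Sum>j\<in>UNIV. f (Busy q j) * rate m c (Busy q j) Idle)
      = (if q = 1 then level f 1 \<bullet> s else 0)" for q
    by (simp add: level_def inner_vec_def)
  show ?thesis
    unfolding sum_wf_states inner by (simp add: sum.delta del: sum.cl_ivl_Suc)
qed

text \<open>For \<open>m = 0\<close> a probe with the complementary probability 1 - c finds the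
  target level 0 already reached, hence the smaller rate.\<close>

lemma outflow_Idle:
  "(\<Sum>z\<in>wf_states m. rate m c Idle z) = (if m = 0 then \<delta> * c else \<delta>)"
proof -
  have inner: "(\<Sum>j\<in>UNIV. rate m c Idle (Busy q j))
      = (if q = m + 1 then \<delta> * c else 0) + (if q = m then if m \<ge> 1 then \<delta> * (1 - c) else 0 else 0)" for q
    by (auto simp: sum.distrib sum_\<alpha> simp flip: sum_distrib_left)
  show ?thesis
    unfolding sum_wf_states inner sum.distrib
    by (auto simp: sum.delta algebra_simps simp del: sum.cl_ivl_Suc)
qed

text \<open>The product with \<open>S\<close> includes the diagonal entry, which is no transition
  rate; it is subtracted at the end and cancels against the same term in
  \<open>outflow_Busy\<close>.\<close>

lemma inflow_Busy:
  assumes q: "q \<in> {1..m+1}"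
  shows "(\<Sum>x\<in>wf_states m. f x * rate m c x (Busy q j)) =
    (level f q v* S
      + (if q \<le> m then (level f (q + 1) \<bullet> s) *\<^sub>R \<alpha> else 0)
      + (if q = m + 1 then (\<delta> * c) *\<^sub>R (f Idle *\<^sub>R \<alpha> + (\<Sum>q'=1..m. level f q')) else 0)
      + (if q = m then (\<delta> * (1 - c)) *\<^sub>R (f Idle *\<^sub>R \<alpha> + (\<Sum>q'=1..<m. level f q')) else 0)) $ j
    - f (Busy q j) * S $ j $ j"
proof -
  have inner: "(\<Sum>i\<in>UNIV. f (Busy q' i) * rate m c (Busy q' i) (Busy q j)) =
      (if q' = q then (level f q v* S) $ j - f (Busy q j) * S $ j $ j else 0)
      + (if q' = q + 1 then (level f (q + 1) \<bullet> s) * \<alpha> $ j else 0)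
      + (if q' \<in> {1..m} then if q = m + 1 then \<delta> * c * level f q' $ j else 0 else 0)
      + (if q' \<in> {1..<m} then if q = m then \<delta> * (1 - c) * level f q' $ j else 0 else 0)"
    if q': "q' \<in> {1..m+1}" for q'
  proof -
    have "(\<Sum>i\<in>UNIV. f (Busy q' i) * rate m c (Busy q' i) (Busy q j)) =
      (\<Sum>i\<in>UNIV. f (Busy q' i) * (if q' = q \<and> j \<noteq> i then S $ i $ j else 0))
      + (\<Sum>i\<in>UNIV. f (Busy q' i) * (if q' = q + 1 then s $ i * \<alpha> $ j else 0))
      + (\<Sum>i\<in>UNIV. f (Busy q' i) * (if q' \<le> m \<and> q = m + 1 \<and> j = i then \<delta> * c else 0))
      + (\<Sum>i\<in>UNIV. f (Busy q' i) * (if q' < m \<and> q = m \<and> j = i then \<delta> * (1 - c) else 0))"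
      using q q' by (simp add: distrib_left sum.distrib) (intro arg_cong2[where f = "(+)"] sum.cong, auto)
    also have "(\<Sum>i\<in>UNIV. f (Busy q' i) * (if q' = q \<and> j \<noteq> i then S $ i $ j else 0))
        = (if q' = q then (level f q v* S) $ j - f (Busy q j) * S $ j $ j else 0)"
    proof (cases "q' = q")
      case True
      have "(\<Sum>i\<in>UNIV. f (Busy q' i) * (if q' = q \<and> j \<noteq> i then S $ i $ j else 0))
          = (\<Sum>i\<in>UNIV. f (Busy q i) * S $ i $ j - (if j = i then f (Busy q j) * S $ j $ j else 0))"
        using True by (intro sum.cong) auto
      also have "\<dots> = (level f q v* S) $ j - f (Busy q j) * S $ j $ j"
        by (simp add: sum_subtractf level_def vector_matrix_mult_def mult.commute)
      finally show ?thesis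
        using True by simp
    qed simp
    also have "(\<Sum>i\<in>UNIV. f (Busy q' i) * (if q' = q + 1 then s $ i * \<alpha> $ j else 0))
        = (if q' = q + 1 then (level f (q + 1) \<bullet> s) * \<alpha> $ j else 0)"
      by (simp add: level_def inner_vec_def sum_distrib_right mult.assoc)
    also have "(\<Sum>i\<in>UNIV. f (Busy q' i) * (if q' \<le> m \<and> q = m + 1 \<and> j = i then \<delta> * c else 0))
        = (if q' \<in> {1..m} then if q = m + 1 then \<delta> * c * level f q' $ j else 0 else 0)"
      using q' by (simp add: level_def if_distrib[of "\<lambda>z. _ * z"] cong: if_cong)
    also have "(\<Sum>i\<in>UNIV. f (Busy q' i) * (if q' < m \<and> q = m \<and> j = i then \<delta> * (1 - c) else 0))
        = (if q' \<in> {1..<m} then if q = m then \<delta> * (1 - c) * level f q' $ j else 0 else 0)"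
      using q' by (simp add: level_def if_distrib[of "\<lambda>z. _ * z"] cong: if_cong)
    finally show ?thesis .
  qed
  have 1: "(\<Sum>q'=1..m+1. if q' = q then g else 0) = g" for g :: real
    using q by (simp add: sum.delta del: sum.cl_ivl_Suc)
  have 2: "(\<Sum>q'=1..m+1. if q' = q + 1 then g else 0) = (if q \<le> m then g else 0)" for g :: real
    using q by (simp add: sum.delta del: sum.cl_ivl_Suc)
  have 3: "(\<Sum>q'=1..m+1. if q' \<in> {1..m} then g q' else 0) = (\<Sum>q'=1..m. g q')"
    and 4: "(\<Sum>q'=1..m+1. if q' \<in> {1..<m} then g q' else 0) = (\<Sum>q'=1..<m. g q')" for g :: "nat \<Rightarrow> real"
    by (intro sum.mono_neutral_cong_right; auto)+
  show ?thesis
    unfolding sum_wf_states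
    by (subst sum.cong[OF refl inner], assumption, unfold sum.distrib 1 2 3 4)
       (use q in \<open>auto simp: sum_component sum_distrib_left sum_subtractf algebra_simps simp del: sum.cl_ivl_Suc\<close>)
qed

text \<open>Row \<open>j\<close> of \<open>S\<close> sums to \<open>- s $ j\<close>, so phase
  changes and completion together have rate \<open>- S $ j $ j\<close>. Completion leads to
  \<open>Idle\<close> from level 1 and to level q - 1 otherwise.\<close>

lemma outflow_Busy:
  assumes q: "q \<in> {1..m+1}"
  shows "(\<Sum>z\<in>wf_states m. rate m c (Busy q j) z) =
    (if q \<le> m then \<delta> * c else 0) + (if q < m then \<delta> * (1 - c) else 0) - S $ j $ j"
proof -
  have inner: "(\<Sum>i\<in>UNIV. rate m c (Busy q j) (Busy q' i)) =
      (if q' = q then - s $ j - S $ j $ j else 0)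
      + (if q' = q - 1 then if q \<ge> 2 then s $ j else 0 else 0)
      + (if q' = m + 1 then if q \<le> m then \<delta> * c else 0 else 0)
      + (if q' = m then if q < m then \<delta> * (1 - c) else 0 else 0)"
    if q': "q' \<in> {1..m+1}" for q'
  proof -
    have "(\<Sum>i\<in>UNIV. rate m c (Busy q j) (Busy q' i)) =
      (\<Sum>i\<in>UNIV. if q' = q \<and> i \<noteq> j then S $ j $ i else 0)
      + (\<Sum>i\<in>UNIV. if q \<ge> 2 \<and> q' = q - 1 then s $ j * \<alpha> $ i else 0)
      + (\<Sum>i\<in>UNIV. if q \<le> m \<and> q' = m + 1 \<and> i = j then \<delta> * c else 0)
      + (\<Sum>i\<in>UNIV. if q < m \<and> q' = m \<and> i = j then \<delta> * (1 - c) else 0)"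
      by (simp add: sum.distrib)
    also have "(\<Sum>i\<in>UNIV. if q' = q \<and> i \<noteq> j then S $ j $ i else 0)
        = (if q' = q then - s $ j - S $ j $ j else 0)"
    proof (cases "q' = q")
      case True
      have "(\<Sum>i\<in>UNIV. if q' = q \<and> i \<noteq> j then S $ j $ i else 0)
          = (\<Sum>i\<in>UNIV. S $ j $ i - (if i = j then S $ j $ j else 0))"
        using True by (intro sum.cong) auto
      also have "\<dots> = - s $ j - S $ j $ j"
        by (simp add: sum_subtractf exit_rates_def matrix_vector_mult_def)
      finally show ?thesis
        using True by simp
    qed simp
    also have "(\<Sum>i\<in>UNIV. if q \<ge> 2 \<and> q' = q - 1 then s $ j * \<alpha> $ i else 0)
        = (if q' = q - 1 then if q \<ge> 2 then s $ j else 0 else 0)"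
      by (auto simp: sum_\<alpha> simp flip: sum_distrib_left)
    also have "(\<Sum>i\<in>UNIV. if q \<le> m \<and> q' = m + 1 \<and> i = j then \<delta> * c else 0)
        = (if q' = m + 1 then if q \<le> m then \<delta> * c else 0 else 0)"
      by simp
    also have "(\<Sum>i\<in>UNIV. if q < m \<and> q' = m \<and> i = j then \<delta> * (1 - c) else 0)
        = (if q' = m then if q < m then \<delta> * (1 - c) else 0 else 0)"
      by simp
    finally show ?thesis .
  qed
  show ?thesis
    unfolding sum_wf_states
    by (subst sum.cong[OF refl inner], assumption, unfold sum.distrib)
       (use q in \<open>auto simp: sum.delta algebra_simps simp del: sum.cl_ivl_Suc\<close>)
qed

lemma balance_iff:
  "(\<forall>z\<in>wf_states m. (\<Sum>x\<in>wf_states m - {z}. f x * rate m c x z)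
      = f z * (\<Sum>x\<in>wf_states m - {z}. rate m c z x)) \<longleftrightarrow>
   level f 1 \<bullet> s = f Idle * (if m = 0 then \<delta> * c else \<delta>) \<and>
   (\<forall>q\<in>{1..m+1}. level f q v* S
      + (if q \<le> m then (level f (q + 1) \<bullet> s) *\<^sub>R \<alpha> else 0)
      + (if q = m + 1 then (\<delta> * c) *\<^sub>R (f Idle *\<^sub>R \<alpha> + (\<Sum>q'=1..m. level f q')) else 0)
      + (if q = m then (\<delta> * (1 - c)) *\<^sub>R (f Idle *\<^sub>R \<alpha> + (\<Sum>q'=1..<m. level f q')) else 0)
      = ((if q \<le> m then \<delta> * c else 0) + (if q < m then \<delta> * (1 - c) else 0)) *\<^sub>R level f q)"
  (is "?balance \<longleftrightarrow> ?idle \<and> (\<forall>q\<in>_. ?in q = ?out q)")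
proof -
  have "?balance \<longleftrightarrow> (\<forall>z\<in>wf_states m. (\<Sum>x\<in>wf_states m. f x * rate m c x z)
      = f z * (\<Sum>x\<in>wf_states m. rate m c z x))"
    by (simp add: sum_remove_zero finite_wf_states wf_rate_diag)
  also have "\<dots> \<longleftrightarrow> ?idle \<and> (\<forall>q\<in>{1..m+1}. \<forall>j.
      (\<Sum>x\<in>wf_states m. f x * rate m c x (Busy q j))
      = f (Busy q j) * (\<Sum>x\<in>wf_states m. rate m c (Busy q j) x))"
    unfolding inflow_Idle[of f m c, symmetric] outflow_Idle[of m c, symmetric]
    by (auto simp: wf_states_def)
  also have "\<dots> \<longleftrightarrow> ?idle \<and> (\<forall>q\<in>{1..m+1}. \<forall>j. ?in q $ j = ?out q $ j)"
    by (intro arg_cong2[of _ _ _ _ conj] ball_cong all_cong refl, subst inflow_Busy, assumption, subst outflow_Busy, assumption)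
       (simp add: level_def algebra_simps)
  finally show ?thesis
    by (simp add: vec_eq_iff)
qed

section \<open>The stationary distribution\<close>

text \<open>
  With state \<open>0\<close> given weight \<open>1\<close>, and \<open>m \<ge> 1\<close>: \<open>low_mass m\<close> is the stationary mass of the states with
  fewer than \<open>m\<close> jobs, split by phase (state \<open>0\<close> counted with phase \<open>\<alpha>\<close>), and
  \<open>overflow_rate m c\<close> is the rate of transitions from \<open>m + 1\<close> to \<open>m\<close>.
\<close>

definition low_mass :: "nat \<Rightarrow> real ^ 'a" where
  "low_mass m = \<alpha> + (\<delta> * (idle_odds m - 1)) *\<^sub>R u"

definition overflow_rate :: "nat \<Rightarrow> real \<Rightarrow> real" where
  "overflow_rate m c = \<delta> * (c + idle_odds m * (1 / y (\<delta> * c) - 1))"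

text \<open>Solves the balance equation of level \<open>m\<close>: inflow from above starts in phase
  \<alpha>, probes bring \<open>low_mass\<close> up, and probes leave at rate \<delta> c.\<close>

definition mass_m :: "nat \<Rightarrow> real \<Rightarrow> real ^ 'a" where
  "mass_m m c = (overflow_rate m c *\<^sub>R \<alpha> + (\<delta> * (1 - c)) *\<^sub>R low_mass m) v* R (\<delta> * c)"

text \<open>The candidate solution with state 0 at weight 1. For \<open>m = 0\<close> the only busy
  level is the top one, fed from state 0; otherwise the last branch is meant for
  \<open>q = m + 1\<close>.\<close>

definition level_mass :: "nat \<Rightarrow> real \<Rightarrow> nat \<Rightarrow> real ^ 'a" where
  "level_mass m c q =
     (if m = 0 then (\<delta> * c) *\<^sub>R (\<alpha> v* R 0)
      else if q < m then (\<delta> * (1 / \<eta>) ^ q) *\<^sub>R u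
      else if q = m then mass_m m c
      else (\<delta> * c) *\<^sub>R ((mass_m m c + low_mass m) v* R 0))"

section \<open>Cut equations for the candidate levels\<close>

lemma idle_odds_mult:
  assumes "m \<ge> 1"
  shows "idle_odds m * (1 - \<eta>) = (1 / \<eta>) ^ (m - 1) - \<eta>"
proof -
  obtain n where m: "m = Suc n"
    using assms by (cases m) auto
  have "\<eta> * idle_odds m = \<eta> + idle_odds n"
    unfolding m idle_odds_Suc' using \<eta>_pos by (simp add: field_simps)
  moreover have "idle_odds m = idle_odds n + (1 / \<eta>) ^ (m - 1)"
    unfolding m idle_odds_Suc by simp
  ultimately show ?thesis
    by (simp add: algebra_simps)
qed

lemma low_mass_one:
  assumes "m \<ge> 1"
  shows "low_mass m \<bullet> 1 = (1 / \<eta>) ^ (m - 1)"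
proof -
  have "low_mass m \<bullet> 1 = 1 + (idle_odds m - 1) * (1 - \<eta>)"
    using \<delta>_pos by (simp add: low_mass_def inner_add_left \<alpha>_one u_one)
  then show ?thesis
    using idle_odds_mult[OF assms] by (simp add: algebra_simps)
qed

text \<open>The cut between m - 1 and \<open>m\<close>: completions at level \<open>m\<close>
  balance the probes, of rate \<delta>, from the mass below. The value of
  \<open>overflow_rate\<close> solves this linear equation.\<close>

lemma low_mass_exit:
  assumes "m \<ge> 1" "0 \<le> c"
  shows "overflow_rate m c * y (\<delta> * c) + \<delta> * (1 - c) * (low_mass m \<bullet> (R (\<delta> * c) *v s))
    = \<delta> * (1 / \<eta>) ^ (m - 1)"
proof -
  define Y where "Y = y (\<delta> * c)"
  have Y: "Y > 0"
    using assms \<delta>_pos no_probe_prob_pos by (simp add: Y_def)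
  have "\<delta> * (1 - c) * (low_mass m \<bullet> (R (\<delta> * c) *v s))
      = \<delta> * ((1 - c) * Y) + \<delta> * (idle_odds m - 1) * (\<delta> * (1 - c) * (u \<bullet> (R (\<delta> * c) *v s)))"
    by (simp add: low_mass_def inner_add_left Y_def no_probe_prob_eq algebra_simps)
  also have "\<dots> = \<delta> * ((1 - c) * Y) + \<delta> * (idle_odds m - 1) * (Y - \<eta>)"
    using assms by (simp add: u_resolvent_exit Y_def)
  finally have "overflow_rate m c * Y + \<delta> * (1 - c) * (low_mass m \<bullet> (R (\<delta> * c) *v s))
      = \<delta> * (idle_odds m * (1 - \<eta>) + \<eta>)"
    using Y by (simp add: overflow_rate_def flip: Y_def) (simp add: algebra_simps)
  then show ?thesis
    using idle_odds_mult[OF assms(1)] by (simp add: Y_def)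
qed

lemma mass_m_exit: "m \<ge> 1 \<Longrightarrow> 0 \<le> c \<Longrightarrow> mass_m m c \<bullet> s = \<delta> * (1 / \<eta>) ^ (m - 1)"
  using low_mass_exit[of m c]
  by (simp add: mass_m_def dot_lmul_matrix inner_add_left flip: no_probe_prob_eq)

lemma mass_m_S:
  "0 \<le> c \<Longrightarrow> mass_m m c v* S
    = (\<delta> * c) *\<^sub>R mass_m m c - (overflow_rate m c *\<^sub>R \<alpha> + (\<delta> * (1 - c)) *\<^sub>R low_mass m)"
  unfolding mass_m_def using \<delta>_pos by (simp add: resolvent_S)

text \<open>The cut between \<open>m\<close> and m + 1, obtained by pairing the equation of level
  \<open>m\<close> with 1 and subtracting the lower cut.\<close>

lemma mass_top_exit:
  assumes m: "m \<ge> 1" and c: "0 \<le> c"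
  shows "(\<delta> * c) * ((mass_m m c + low_mass m) \<bullet> 1) = overflow_rate m c"
proof -
  have "mass_m m c \<bullet> s = - ((mass_m m c v* S) \<bullet> 1)"
    by (simp add: dot_lmul_matrix S_one)
  also have "\<dots> = overflow_rate m c + \<delta> * (1 - c) * (low_mass m \<bullet> 1) - \<delta> * c * (mass_m m c \<bullet> 1)"
    unfolding mass_m_S[OF c] by (simp add: inner_diff_left inner_add_left \<alpha>_one)
  finally show ?thesis
    using mass_m_exit[OF m c] low_mass_one[OF m] by (simp add: inner_add_left algebra_simps)
qed

lemma level_mass_exit:
  assumes c: "0 \<le> c"
  shows "1 \<le> q \<Longrightarrow> q \<le> m \<Longrightarrow> level_mass m c q \<bullet> s = \<delta> * (1 / \<eta>) ^ (q - 1)"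
    and "m \<ge> 1 \<Longrightarrow> level_mass m c (m + 1) \<bullet> s = overflow_rate m c"
    and "level_mass 0 c q \<bullet> s = \<delta> * c"
proof -
  show "level_mass m c q \<bullet> s = \<delta> * (1 / \<eta>) ^ (q - 1)" if "1 \<le> q" "q \<le> m"
  proof (cases "q = m")
    case True
    with that c show ?thesis
      by (simp add: level_mass_def mass_m_exit)
  next
    case False
    from that(1) obtain k where "q = Suc k"
      by (cases q) auto
    with False that \<eta>_pos show ?thesis
      by (simp add: level_mass_def u_exit)
  qed
  show "level_mass m c (m + 1) \<bullet> s = overflow_rate m c" if "m \<ge> 1"
    using mass_top_exit[OF that c] that
    by (simp add: level_mass_def dot_lmul_matrix resolvent_0_exit)
  show "level_mass 0 c q \<bullet> s = \<delta> * c"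
    by (simp add: level_mass_def dot_lmul_matrix resolvent_0_exit \<alpha>_one)
qed

lemma sum_level_mass:
  assumes "m \<ge> 1"
  shows "\<alpha> + (\<Sum>q=1..<m. level_mass m c q) = low_mass m"
proof -
  have "(\<Sum>q=1..<m. level_mass m c q) = (\<Sum>q=1..<m. (\<delta> * (1 / \<eta>) ^ q) *\<^sub>R u)"
    by (intro sum.cong) (auto simp: level_mass_def)
  also have "\<dots> = (\<delta> * (\<Sum>q=1..<m. (1 / \<eta>) ^ q)) *\<^sub>R u"
    by (simp add: scaleR_sum_left sum_distrib_left)
  also have "(\<Sum>q=1..<m. (1 / \<eta>) ^ q) = idle_odds m - 1"
    using assms by (simp add: idle_odds_def lessThan_atLeast0 sum.atLeast_Suc_lessThan[of 0 m])
  finally show ?thesis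
    by (simp add: low_mass_def)
qed

text \<open>From left to right the levels are solved from the bottom up; from right to left the exit
  rates of the candidate verify each equation.\<close>

lemma balance_iff_level_mass:
  assumes c: "0 \<le> c"
  shows "(\<forall>z\<in>wf_states m. (\<Sum>x\<in>wf_states m - {z}. f x * rate m c x z)
      = f z * (\<Sum>x\<in>wf_states m - {z}. rate m c z x)) \<longleftrightarrow>
    (\<forall>q\<in>{1..m+1}. level f q = f Idle *\<^sub>R level_mass m c q)"
    (is "?balance \<longleftrightarrow> ?sol")
proof (cases "m = 0")
  case True
  have "?balance \<longleftrightarrow> level f 1 \<bullet> s = f Idle * (\<delta> * c)
      \<and> level f 1 v* S + (\<delta> * c) *\<^sub>R (f Idle *\<^sub>R \<alpha>) = 0"
    unfolding balance_iff using True by simp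
  also have "\<dots> \<longleftrightarrow> level f 1 = f Idle *\<^sub>R level_mass m c 1"
  proof
    assume "level f 1 \<bullet> s = f Idle * (\<delta> * c) \<and> level f 1 v* S + (\<delta> * c) *\<^sub>R (f Idle *\<^sub>R \<alpha>) = 0"
    then have "((\<delta> * c) *\<^sub>R (f Idle *\<^sub>R \<alpha>)) v* R 0 = level f 1"
      by (intro resolvent_unique_left) (auto simp: add_eq_0_iff)
    then show "level f 1 = f Idle *\<^sub>R level_mass m c 1"
      using True by (simp add: level_mass_def scaleR_vector_matrix_assoc mult.commute)
  next
    assume "level f 1 = f Idle *\<^sub>R level_mass m c 1"
    then show "level f 1 \<bullet> s = f Idle * (\<delta> * c) \<and> level f 1 v* S + (\<delta> * c) *\<^sub>R (f Idle *\<^sub>R \<alpha>) = 0"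
      using True level_mass_exit(3)[OF c, of 1]
      by (simp add: level_mass_def scaleR_vector_matrix_assoc resolvent_S)
  qed
  finally show ?thesis
    using True by simp
next
  case False
  then have m: "m \<ge> 1" by simp
  have dc: "0 \<le> \<delta> * c"
    using \<delta>_pos c by simp
  define p where "p = f Idle"
  have sum_m: "(\<Sum>q=1..m. g q) = (\<Sum>q=1..<m. g q) + g m" for g :: "nat \<Rightarrow> real ^ 'a"
    using m by (metis One_nat_def Suc_eq_plus1 atLeastLessThanSuc_atLeastAtMost sum.atLeastLessThan_Suc)
  \<comment> \<open>Three types of level remain: below \<open>m\<close> every probe moves the queue,
    at total rate \<delta>; level \<open>m\<close> is left by probes at rate \<delta> c only; the
    top level is not left by probes.\<close>
  have "?balance \<longleftrightarrow> level f 1 \<bullet> s = p * \<delta>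
      \<and> (\<forall>q\<in>{1..<m}. level f q v* S + (level f (q + 1) \<bullet> s) *\<^sub>R \<alpha> = \<delta> *\<^sub>R level f q)
      \<and> level f m v* S + (level f (m + 1) \<bullet> s) *\<^sub>R \<alpha>
          + (\<delta> * (1 - c)) *\<^sub>R (p *\<^sub>R \<alpha> + (\<Sum>q=1..<m. level f q)) = (\<delta> * c) *\<^sub>R level f m
      \<and> level f (m + 1) v* S
          + (\<delta> * c) *\<^sub>R (p *\<^sub>R \<alpha> + ((\<Sum>q=1..<m. level f q) + level f m)) = 0"
    (is "_ \<longleftrightarrow> ?idle \<and> ?low \<and> ?mid \<and> ?top")
  proof -
    have levels: "{1..m+1} = {1..<m} \<union> {m, m + 1}"
      using m by auto
    have "\<delta> * c + \<delta> * (1 - c) = \<delta>"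
      by (simp add: algebra_simps)
    then show ?thesis
      unfolding balance_iff p_def[symmetric] levels ball_Un sum_m[symmetric]
      using False by simp
  qed
  also have "\<dots> \<longleftrightarrow> ?sol"
  proof
    assume "?idle \<and> ?low \<and> ?mid \<and> ?top"
    then have idle: ?idle and low: ?low and mid: ?mid and top: ?top
      by auto
    have low_u: "level f q = (level f (q + 1) \<bullet> s) *\<^sub>R u" if "q \<in> {1..<m}" for q
    proof -
      have "((level f (q + 1) \<bullet> s) *\<^sub>R \<alpha>) v* R \<delta> = level f q"
        using low that \<delta>_pos by (intro resolvent_unique_left) (auto simp: algebra_simps)
      then show ?thesis
        by (simp add: scaleR_vector_matrix_assoc)
    qed
    \<comment> \<open>Since \<open>u \<bullet> s = \<eta>\<close>, pairing with \<open>s\<close>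
      turns the vector equation into a scalar recursion with ratio
      \<open>1 / \<eta>\<close>.\<close>
    have step: "level f (q + 1) \<bullet> s = (level f q \<bullet> s) / \<eta>" if "q \<in> {1..<m}" for q
      using arg_cong[OF low_u[OF that], of "\<lambda>v. v \<bullet> s"] \<eta>_pos by (simp add: u_exit)
    have exit: "q < m \<Longrightarrow> level f (q + 1) \<bullet> s = p * \<delta> * (1 / \<eta>) ^ q" for q
    proof (induction q)
      case 0
      then show ?case using idle by simp
    next
      case (Suc q)
      then show ?case using step[of "Suc q"] by simp
    qed
    have sol_low: "level f q = p *\<^sub>R level_mass m c q" if "q \<in> {1..<m}" for q
      using low_u[OF that] exit[of q] that by (simp add: level_mass_def)
    have low_mass: "p *\<^sub>R \<alpha> + (\<Sum>q=1..<m. level f q) = p *\<^sub>R low_mass m"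
      using sol_low by (simp add: scaleR_add_right scaleR_sum_right flip: sum_level_mass[OF m, of c])
    \<comment> \<open>The flow down from the top level is still unknown. Level \<open>m\<close> is
      expressed through it, and the exit rate of level \<open>m\<close>, known from the recursion,
      then determines \<open>a\<close> because \<open>y (\<delta> * c)\<close> is positive.\<close>
    define a where "a = level f (m + 1) \<bullet> s"
    have lm: "(a *\<^sub>R \<alpha> + (\<delta> * (1 - c)) *\<^sub>R (p *\<^sub>R low_mass m)) v* R (\<delta> * c) = level f m"
      using mid unfolding low_mass a_def by (intro resolvent_unique_left dc) (simp add: algebra_simps)
    have "p * (\<delta> * (1 / \<eta>) ^ (m - 1)) = level f m \<bullet> s"
      using exit[of "m - 1"] m by simp
    also have "\<dots> = a * y (\<delta> * c) + p * (\<delta> * (1 - c) * (low_mass m \<bullet> (R (\<delta> * c) *v s)))"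
      unfolding lm[symmetric] dot_lmul_matrix inner_add_left by (simp add: no_probe_prob_eq)
    finally have "a * y (\<delta> * c) = p * overflow_rate m c * y (\<delta> * c)"
      unfolding low_mass_exit[OF m c, symmetric] by (auto simp: algebra_simps)
    then have a: "a = p * overflow_rate m c"
      using no_probe_prob_pos[OF dc] by simp
    have sol_m: "level f m = p *\<^sub>R level_mass m c m"
      unfolding lm[symmetric] a using False
      by (simp add: level_mass_def mass_m_def mult.left_commute
          flip: scaleR_vector_matrix_assoc scaleR_add_right) (simp add: algebra_simps)
    have "((\<delta> * c) *\<^sub>R (p *\<^sub>R (low_mass m + mass_m m c))) v* R 0 = level f (m + 1)"
      using top False unfolding add.assoc[symmetric] low_mass sol_m
      by (intro resolvent_unique_left) (auto simp: level_mass_def add_eq_0_iff scaleR_add_right)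
    then have sol_top: "level f (m + 1) = p *\<^sub>R level_mass m c (m + 1)"
      using False by (simp add: level_mass_def scaleR_vector_matrix_assoc add.commute mult.commute)
    show ?sol
    proof
      fix q
      assume "q \<in> {1..m+1}"
      then consider "q \<in> {1..<m}" | "q = m" | "q = m + 1"
        by fastforce
      then show "level f q = f Idle *\<^sub>R level_mass m c q"
        unfolding p_def[symmetric] using sol_low sol_m sol_top by cases blast+
    qed
  next
    assume sol: ?sol
    have lev: "level f q = p *\<^sub>R level_mass m c q" if "q \<in> {1..m+1}" for q
      using sol that by (auto simp: p_def)
    have low_mass: "p *\<^sub>R \<alpha> + (\<Sum>q=1..<m. level f q) = p *\<^sub>R low_mass m"
      using lev by (simp add: scaleR_add_right scaleR_sum_right flip: sum_level_mass[OF m, of c])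
    have ?idle
      using lev[of 1] level_mass_exit(1)[OF c, of 1 m] m by simp
    moreover have ?low
    proof
      fix q
      assume q: "q \<in> {1..<m}"
      have "level_mass m c q v* S = \<delta> *\<^sub>R level_mass m c q - (\<delta> * (1 / \<eta>) ^ q) *\<^sub>R \<alpha>"
        using q \<delta>_pos by (simp add: level_mass_def scaleR_vector_matrix_assoc resolvent_S algebra_simps)
      then show "level f q v* S + (level f (q + 1) \<bullet> s) *\<^sub>R \<alpha> = \<delta> *\<^sub>R level f q"
        using q lev[of q] lev[of "q + 1"] level_mass_exit(1)[OF c, of "q + 1" m]
        by (simp add: scaleR_vector_matrix_assoc scaleR_diff_right mult.commute mult.left_commute)
    qed
    moreover have ?mid
    proof -
      have "level f (m + 1) \<bullet> s = p * overflow_rate m c"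
        using lev[of "m + 1"] level_mass_exit(2)[OF c m] by simp
      moreover have "level f m = p *\<^sub>R mass_m m c"
        using lev[of m] m by (simp add: level_mass_def)
      ultimately show ?thesis
        unfolding low_mass by (simp add: scaleR_vector_matrix_assoc mass_m_S[OF c] algebra_simps)
    qed
    moreover have ?top
      unfolding add.assoc[symmetric] low_mass using lev[of m] lev[of "m + 1"] m
      by (simp add: level_mass_def scaleR_vector_matrix_assoc resolvent_S algebra_simps)
    ultimately show "?idle \<and> ?low \<and> ?mid \<and> ?top"
      by blast
  qed
  finally show ?thesis .
qed

section \<open>Nonnegativity and normalisation of the candidate\<close>

lemma level_mass_nonneg:
  assumes c: "0 \<le> c" "c \<le> 1"
  shows "0 \<le> level_mass m c q $ i"
proof -
  have dc: "0 \<le> \<delta> * c"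
    using \<delta>_pos c by simp
  have u: "0 \<le> u $ i" for i
    by (intro resolvent_nonneg_left \<alpha>_nonneg \<delta>_nonneg)
  have low: "0 \<le> low_mass m $ i" if "m \<ge> 1" for i
  proof -
    \<comment> \<open>The term with exponent 0 already contributes 1, so the coefficient of
      \<open>u\<close> in \<open>low_mass m\<close> is nonnegative.\<close>
    have "1 \<le> idle_odds m"
      using that sum_mono2[of "{..<m}" "{0}" "\<lambda>k. (1 / \<eta>) ^ k"] \<eta>_pos by (auto simp: idle_odds_def)
    then show ?thesis
      using u \<alpha>_nonneg \<delta>_pos by (simp add: low_mass_def)
  qed
  have "0 \<le> overflow_rate m c"
    using \<delta>_pos c idle_odds_nonneg[of m] no_probe_prob_le_1[OF dc] no_probe_prob_pos[OF dc]
    by (auto simp: overflow_rate_def intro!: mult_nonneg_nonneg add_nonneg_nonneg)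
  then have mid: "0 \<le> mass_m m c $ i" if "m \<ge> 1" for i
    unfolding mass_m_def using low[OF that] \<alpha>_nonneg \<delta>_pos c dc
    by (intro resolvent_nonneg_left) auto
  show ?thesis
    using mid low u c \<delta>_pos \<eta>_pos \<alpha>_nonneg
    by (auto simp: level_mass_def intro!: mult_nonneg_nonneg resolvent_nonneg_left)
qed

lemma total_mass:
  assumes c: "0 \<le> c"
  shows "1 + (\<Sum>q=1..m+1. level_mass m c q \<bullet> 1) = idle_inv m c"
proof (cases "m = 0")
  case True
  then show ?thesis
    by (simp add: level_mass_def dot_lmul_matrix mean_resolvent idle_inv_def idle_odds_def)
next
  case False
  then have m: "m \<ge> 1" by simp
  let ?t = "R 0 *v 1"
  have "{1..m+1} = insert (m + 1) (insert m {1..<m})"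
    using m by auto
  then have "1 + (\<Sum>q=1..m+1. level_mass m c q \<bullet> 1)
      = (\<alpha> + (\<Sum>q=1..<m. level_mass m c q)) \<bullet> 1 + level_mass m c m \<bullet> 1 + level_mass m c (m + 1) \<bullet> 1"
    by (simp add: inner_add_left inner_sum_left \<alpha>_one)
  also have "\<dots> = low_mass m \<bullet> 1 + mass_m m c \<bullet> 1 + \<delta> * c * (mass_m m c \<bullet> ?t) + \<delta> * c * (low_mass m \<bullet> ?t)"
    unfolding sum_level_mass[OF m] using False
    by (simp add: level_mass_def dot_lmul_matrix inner_add_left algebra_simps)
  \<comment> \<open>Since \<open>S *v ?t = - 1\<close>, this brings in the equation of level
    \<open>m\<close>; its term in \<open>mass_m m c \<bullet> ?t\<close> cancels the one coming from
    the top level.\<close>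
  also have "mass_m m c \<bullet> 1 = - ((mass_m m c v* S) \<bullet> ?t)"
    by (simp add: dot_lmul_matrix S_resolvent)
  also have "\<dots> = overflow_rate m c + \<delta> * (1 - c) * (low_mass m \<bullet> ?t) - \<delta> * c * (mass_m m c \<bullet> ?t)"
    unfolding mass_m_S[OF c] by (simp add: inner_diff_left inner_add_left mean_resolvent)
  finally have "1 + (\<Sum>q=1..m+1. level_mass m c q \<bullet> 1)
      = low_mass m \<bullet> 1 + overflow_rate m c + \<delta> * (low_mass m \<bullet> ?t)"
    by (simp add: algebra_simps)
  also have "low_mass m \<bullet> 1 = 1 + (idle_odds m - 1) * (1 - \<eta>)"
    using \<delta>_pos by (simp add: low_mass_def inner_add_left \<alpha>_one u_one)
  also have "\<delta> * (low_mass m \<bullet> ?t) = \<delta> + (idle_odds m - 1) * (\<delta> * (1 - (1 - \<eta>) / \<delta>))"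
    using \<delta>_pos by (simp add: low_mass_def inner_add_left mean_resolvent u_mean distrib_left)
  also have "\<delta> * (1 - (1 - \<eta>) / \<delta>) = \<delta> - (1 - \<eta>)"
    using \<delta>_pos by (simp add: field_simps)
  also have "1 + (idle_odds m - 1) * (1 - \<eta>) + overflow_rate m c
      + (\<delta> + (idle_odds m - 1) * (\<delta> - (1 - \<eta>))) = idle_inv m c"
    by (simp add: overflow_rate_def idle_inv_def algebra_simps)
  finally show ?thesis .
qed

lemma stationary_iff:
  assumes c: "0 \<le> c"
  shows "stationary_distribution (wf_states m) (rate m c) \<pi> \<longleftrightarrow>
    set_pmf \<pi> \<subseteq> wf_states m \<and> pmf \<pi> Idle = 1 / idle_inv m c \<and>
    (\<forall>q\<in>{1..m+1}. \<forall>j. pmf \<pi> (Busy q j) = level_mass m c q $ j / idle_inv m c)"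
proof -
  have total: "pmf \<pi> Idle = 1 / idle_inv m c"
    if sup: "set_pmf \<pi> \<subseteq> wf_states m"
      and lev: "\<forall>q\<in>{1..m+1}. level (pmf \<pi>) q = pmf \<pi> Idle *\<^sub>R level_mass m c q"
  proof -
    have "1 = (\<Sum>x\<in>wf_states m. pmf \<pi> x)"
      by (intro sum_pmf_eq_1[symmetric] finite_wf_states sup)
    also have "\<dots> = pmf \<pi> Idle + (\<Sum>q=1..m+1. level (pmf \<pi>) q \<bullet> 1)"
      by (simp add: sum_wf_states level_def inner_vec_def)
    also have "(\<Sum>q=1..m+1. level (pmf \<pi>) q \<bullet> 1) = pmf \<pi> Idle * (\<Sum>q=1..m+1. level_mass m c q \<bullet> 1)"
      using lev by (simp add: sum_distrib_left del: sum.cl_ivl_Suc)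
    also have "pmf \<pi> Idle + pmf \<pi> Idle * (\<Sum>q=1..m+1. level_mass m c q \<bullet> 1)
        = pmf \<pi> Idle * idle_inv m c"
      unfolding total_mass[OF c, symmetric] by (simp only: distrib_left mult_1_right)
    finally show ?thesis
      using idle_inv_pos[OF c, of m] by (simp add: field_simps)
  qed
  have "stationary_distribution (wf_states m) (rate m c) \<pi> \<longleftrightarrow> set_pmf \<pi> \<subseteq> wf_states m \<and>
      (\<forall>q\<in>{1..m+1}. level (pmf \<pi>) q = pmf \<pi> Idle *\<^sub>R level_mass m c q)"
    unfolding stationary_distribution_def balance_iff_level_mass[OF c] ..
  also have "\<dots> \<longleftrightarrow> set_pmf \<pi> \<subseteq> wf_states m \<and> pmf \<pi> Idle = 1 / idle_inv m c \<and>
      (\<forall>q\<in>{1..m+1}. level (pmf \<pi>) q = pmf \<pi> Idle *\<^sub>R level_mass m c q)"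
    using total by blast
  finally show ?thesis
    by (auto simp: vec_eq_iff level_def)
qed

text \<open>Justifies the definite description in \<open>wf_stationary\<close>.\<close>

lemma ex1_stationary:
  assumes c: "0 \<le> c" "c \<le> 1"
  shows "\<exists>!\<pi>. stationary_distribution (wf_states m) (rate m c) \<pi>"
proof (rule ex_ex1I)
  \<comment> \<open>The values forced by \<open>stationary_iff\<close>, extended by 0 to all states
    as \<open>embed_pmf\<close> requires.\<close>
  define g where "g = (\<lambda>x. case x of Idle \<Rightarrow> 1 / idle_inv m c
    | Busy q j \<Rightarrow> if q \<in> {1..m+1} then level_mass m c q $ j / idle_inv m c else 0)"
  have D: "0 < idle_inv m c"
    using idle_inv_pos c by simp
  have g_nonneg: "0 \<le> g x" for x
    using D level_mass_nonneg[OF c] by (auto simp: g_def split: state.splits)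
  have g_supp: "g x \<noteq> 0 \<Longrightarrow> x \<in> wf_states m" for x
    by (auto simp: g_def wf_states_def split: state.splits if_splits)
  have "(\<Sum>x\<in>wf_states m. g x)
      = 1 / idle_inv m c + (\<Sum>q=1..m+1. (level_mass m c q \<bullet> 1) / idle_inv m c)"
    unfolding sum_wf_states
    by (intro arg_cong2[where f = "(+)"] sum.cong)
       (auto simp: g_def inner_vec_def sum_divide_distrib)
  also have "\<dots> = (1 + (\<Sum>q=1..m+1. level_mass m c q \<bullet> 1)) / idle_inv m c"
    by (simp add: add_divide_distrib sum_divide_distrib del: sum.cl_ivl_Suc)
  also have "\<dots> = 1"
    unfolding total_mass[OF c(1)] using D by simp
  finally have sum_g: "(\<Sum>x\<in>wf_states m. g x) = 1" .
  have "(\<integral>\<^sup>+ x. ennreal (g x) \<partial>count_space UNIV) = (\<Sum>x\<in>wf_states m. ennreal (g x))"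
    by (intro nn_integral_count_space'[OF finite_wf_states]) (use g_supp in force)+
  also have "\<dots> = 1"
    using sum_g g_nonneg by (simp add: sum_ennreal)
  finally have pmf_g: "pmf (embed_pmf g) x = g x" for x
    using g_nonneg by (intro pmf_embed_pmf)
  have "stationary_distribution (wf_states m) (rate m c) (embed_pmf g)"
    unfolding stationary_iff[OF c(1)] using g_supp
    by (auto simp: pmf_g set_pmf_iff) (auto simp: g_def)
  then show "\<exists>\<pi>. stationary_distribution (wf_states m) (rate m c) \<pi>" ..
next
  fix \<pi> \<rho>
  assume "stationary_distribution (wf_states m) (rate m c) \<pi>"
    and "stationary_distribution (wf_states m) (rate m c) \<rho>"
  then have st: "set_pmf \<pi> \<subseteq> wf_states m" "set_pmf \<rho> \<subseteq> wf_states m"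
      "\<And>x. x \<in> wf_states m \<Longrightarrow> pmf \<pi> x = pmf \<rho> x"
    unfolding stationary_iff[OF c(1)] by (auto simp: wf_states_def)
  show "\<pi> = \<rho>"
  proof (rule pmf_eqI)
    fix x
    show "pmf \<pi> x = pmf \<rho> x"
      using st by (cases "x \<in> wf_states m") (simp, metis set_pmf_iff subsetD)
  qed
qed

lemma wf_idle_prob_eq:
  assumes c: "0 \<le> c" "c \<le> 1"
  shows "wf_idle_prob \<delta> \<alpha> S m c = 1 / idle_inv m c"
  using theI'[OF ex1_stationary[OF c]] c
  by (simp add: wf_idle_prob_def wf_stationary_def stationary_iff)

section \<open>Existence and uniqueness of the parameters\<close>

text \<open>
  Since \<open>y 0 = 1\<close>, the value of \<open>idle_inv m c\<close> at \<open>c = 1\<close> is that of \<open>idle_inv (m + 1) c\<close> at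
  \<open>c = 0\<close>, so \<open>(m, c) \<mapsto> idle_inv m c\<close> is a lexicographically increasing bijection onto \<open>[1, \<infinity>)\<close>.
\<close>

lemma idle_inv_0: "idle_inv m 0 = 1 + \<delta> * idle_odds m"
  and idle_inv_1: "idle_inv m 1 = 1 + \<delta> * idle_odds (Suc m)"
  unfolding idle_odds_Suc' by (simp_all add: idle_inv_def algebra_simps)

text \<open>Strictness comes from the linear term \<delta> c; the quotient is only weakly
  increasing, being constant for \<open>m = 0\<close>.\<close>

lemma idle_inv_strict_mono:
  assumes "0 \<le> c" "c < c'"
  shows "idle_inv m c < idle_inv m c'"
proof -
  have "\<delta> * idle_odds m / y (\<delta> * c) \<le> \<delta> * idle_odds m / y (\<delta> * c')"
    using assms \<delta>_pos idle_odds_nonneg[of m]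
    by (intro divide_left_mono no_probe_prob_antimono mult_pos_pos mult_nonneg_nonneg no_probe_prob_pos) auto
  then show ?thesis
    using assms \<delta>_pos by (simp add: idle_inv_def add_less_le_mono)
qed

lemma continuous_on_idle_inv: "continuous_on {0..1} (idle_inv m)"
proof -
  have "continuous_on {0..1} (\<lambda>c. y (\<delta> * c))"
    using \<delta>_pos
    by (intro continuous_on_compose2[OF continuous_on_no_probe_prob] continuous_intros) auto
  moreover have "y (\<delta> * c) \<noteq> 0" if "c \<in> {0..1}" for c
    using no_probe_prob_pos[of "\<delta> * c"] that \<delta>_pos by simp
  ultimately show ?thesis
    unfolding idle_inv_def by (intro continuous_intros) auto
qed

text \<open>The number \<open>L\<close> stands for \<lambda> / (\<delta> (1 - \<lambda>)).
  Monotonicity places \<open>idle_inv m c\<close> between its values at \<open>c = 0\<close> and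
  \<open>c = 1\<close>, which are given by consecutive geometric sums.\<close>

lemma idle_odds_bracket:
  assumes c: "c \<in> {0..<1}" and eq: "1 + \<delta> * L = idle_inv m c"
  shows "idle_odds m \<le> L" "L < idle_odds (Suc m)"
proof -
  have "idle_inv m 0 \<le> idle_inv m c"
    using idle_inv_strict_mono[of 0 c m] c by (cases "c = 0") auto
  then show "idle_odds m \<le> L"
    using \<delta>_pos by (simp add: idle_inv_0 flip: eq)
  have "idle_inv m c < idle_inv m 1"
    using idle_inv_strict_mono[of c 1 m] c by auto
  then show "L < idle_odds (Suc m)"
    using \<delta>_pos by (simp add: idle_inv_1 flip: eq)
qed

lemma idle_odds_bracket_iff:
  "idle_odds m \<le> L \<and> L < idle_odds (Suc m) \<longleftrightarrow>
    (1 / \<eta>) ^ m \<le> 1 + L * (1 / \<eta> - 1) \<and> 1 + L * (1 / \<eta> - 1) < (1 / \<eta>) ^ Suc m"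
proof -
  have "0 < 1 / \<eta> - 1"
    using \<eta>_pos \<eta>_less_1 by simp
  then show ?thesis
    unfolding idle_odds_eq by (auto simp: divide_le_eq less_divide_eq simp del: power_Suc)
qed

text \<open>Take logarithms to base \<open>1 / \<eta>\<close>, which exceeds 1.\<close>

lemma bracket_iff_floor:
  assumes "0 \<le> L"
  shows "(1 / \<eta>) ^ m \<le> 1 + L * (1 / \<eta> - 1) \<and> 1 + L * (1 / \<eta> - 1) < (1 / \<eta>) ^ Suc m \<longleftrightarrow>
    int m = \<lfloor>ln (1 + L * (1 / \<eta> - 1)) / ln (1 / \<eta>)\<rfloor>"
proof -
  define b where "b = 1 / \<eta>"
  define x where "x = 1 + L * (b - 1)"
  have b: "1 < b"
    using \<eta>_pos \<eta>_less_1 by (simp add: b_def)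
  then have x: "0 < x"
    using assms by (simp add: x_def add_pos_nonneg)
  have lnb: "0 < ln b"
    using b by simp
  have "b ^ m \<le> x \<longleftrightarrow> real m \<le> ln x / ln b" for m
  proof -
    have "b ^ m \<le> x \<longleftrightarrow> ln (b ^ m) \<le> ln x"
      using b x by (subst ln_le_cancel_iff) auto
    also have "\<dots> \<longleftrightarrow> real m \<le> ln x / ln b"
      using b lnb by (simp add: ln_realpow le_divide_eq)
    finally show ?thesis .
  qed
  from this[of m] this[of "Suc m"]
  have "b ^ m \<le> x \<and> x < b ^ Suc m \<longleftrightarrow> real m \<le> ln x / ln b \<and> ln x / ln b < real m + 1"
    by (simp add: not_le[symmetric] add.commute del: power_Suc)
  also have "\<dots> \<longleftrightarrow> int m = \<lfloor>ln x / ln b\<rfloor>"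
    by (metis floor_eq_iff of_int_of_nat_eq)
  finally show ?thesis
    by (simp only: b_def x_def)
qed

text \<open>The floor formula supplies \<open>m\<close> and continuity supplies \<open>c\<close>;
  this justifies the definite description in \<open>wf_cavity_params\<close>.\<close>

lemma ex1_params:
  assumes L: "0 \<le> L"
  shows "\<exists>!(m, c). c \<in> {0..<1} \<and> idle_inv m c = 1 + \<delta> * L"
proof -
  define n where "n = nat \<lfloor>ln (1 + L * (1 / \<eta> - 1)) / ln (1 / \<eta>)\<rfloor>"
  have b: "1 < 1 / \<eta>"
    using \<eta>_pos \<eta>_less_1 by simp
  have "0 \<le> ln (1 + L * (1 / \<eta> - 1)) / ln (1 / \<eta>)"
    using b L by (intro divide_nonneg_nonneg ln_ge_zero) auto
  then have "int n = \<lfloor>ln (1 + L * (1 / \<eta> - 1)) / ln (1 / \<eta>)\<rfloor>"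
    by (simp add: n_def)
  then have n: "idle_odds n \<le> L" "L < idle_odds (Suc n)"
    using bracket_iff_floor[OF L] idle_odds_bracket_iff by blast+
  \<comment> \<open>The bracket of \<open>L\<close> gives the endpoint values for the intermediate
    value theorem; strictness on the right excludes \<open>c = 1\<close>.\<close>
  have "idle_inv n 0 \<le> 1 + \<delta> * L" "1 + \<delta> * L < idle_inv n 1"
    using n \<delta>_pos by (simp_all add: idle_inv_0 idle_inv_1)
  then obtain c where c: "0 \<le> c" "c \<le> 1" "idle_inv n c = 1 + \<delta> * L"
    using IVT'[of "idle_inv n" 0 "1 + \<delta> * L" 1] continuous_on_idle_inv by auto
  then have c1: "c \<in> {0..<1}"
    using \<open>1 + \<delta> * L < idle_inv n 1\<close> by (cases "c = 1") auto
  show ?thesis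
  proof (intro ex1I[of _ "(n, c)"], clarsimp simp: c c1)
    show "c < 1" using c1 by simp
    fix mc
    assume "case mc of (m, c) \<Rightarrow> c \<in> {0..<1} \<and> idle_inv m c = 1 + \<delta> * L"
    then obtain m' c' where mc: "mc = (m', c')" "c' \<in> {0..<1}" "1 + \<delta> * L = idle_inv m' c'"
      by (auto split: prod.splits)
    \<comment> \<open>Any solution puts \<open>L\<close> into the bracket of its own
      \<open>m'\<close>, and the floor characterisation identifies that index.\<close>
    then have "m' = n"
      using idle_odds_bracket[OF mc(2,3)] n idle_odds_bracket_iff bracket_iff_floor[OF L]
      by (metis of_nat_eq_iff)
    moreover have "c' = c"
      using idle_inv_strict_mono[of c c' n] idle_inv_strict_mono[of c' c n] c c1 mc \<open>m' = n\<close>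
      by (cases c c' rule: linorder_cases) auto
    ultimately show "mc = (n, c)"
      by (simp add: mc)
  qed
qed

end

section \<open>The closed form of the cavity parameters\<close>

theorem theorem5p1:
  fixes lam \<delta> y m_tilde c :: real and m :: nat
    and \<alpha> :: "real ^ 'n" and S :: "real ^ 'n ^ 'n"
    and F :: "real \<Rightarrow> real"
  assumes "0 \<le> lam" and "lam < 1" and "\<delta> > 0"
    and "phase_type \<alpha> S" and "ph_mean \<alpha> S = 1"
    and "y = no_probe_prob \<delta> \<alpha> S"
    and "(m, c) = wf_cavity_params lam \<delta> \<alpha> S"
    and "m_tilde = ln (1 / y + (lam / (\<delta> * (1 - lam)) - 1) * ((1 - y) / y)) / ln (1 / y)"
    and "F = (\<lambda>c. (y powi (int m - 1) / \<delta>) /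
                   (1 / \<delta> + wf_kappa \<delta> \<alpha> S m c \<bullet> (matrix_inv (- wf_K \<delta> \<alpha> S c) *v 1)))"
  shows "int m = \<lfloor>m_tilde\<rfloor> \<and>
         c \<in> {0..<1} \<and> 1 - lam = F c \<and>
         (\<forall>c'\<in>{0..<1}. 1 - lam = F c' \<longrightarrow> c' = c)"
proof -
  interpret water_filling \<alpha> S \<delta>
    by unfold_locales (use assms in auto)
  \<comment> \<open>Chosen so that \<open>1 + \<delta> * L\<close> is \<open>1 / (1 - lam)\<close>,
    the value that \<open>idle_inv\<close> must take.\<close>
  define L where "L = lam / (\<delta> * (1 - lam))"
  have L: "0 \<le> L"
    using assms by (simp add: L_def)
  have L_eq: "1 / (1 - lam) = 1 + \<delta> * L"
    using assms by (simp add: L_def field_simps)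
  have idle_iff: "1 / idle_inv m c = 1 - lam \<longleftrightarrow> idle_inv m c = 1 + \<delta> * L"
    if "c \<in> {0..<1}" for m c
    unfolding L_eq[symmetric]
    using \<open>lam < 1\<close> idle_inv_pos[of c m] that by (auto simp: field_simps)
  have params: "wf_cavity_params lam \<delta> \<alpha> S
      = (THE (m, c). c \<in> {0..<1} \<and> idle_inv m c = 1 + \<delta> * L)"
    unfolding wf_cavity_params_def
    by (intro arg_cong[where f = The] ext) (auto simp: wf_idle_prob_eq idle_iff simp flip: L_eq)
  have mc: "c \<in> {0..<1}" "idle_inv m c = 1 + \<delta> * L"
    using theI'[OF ex1_params[OF L]] unfolding params[symmetric] assms(7)[symmetric] by auto
  have F: "1 - lam = F c' \<longleftrightarrow> idle_inv m c' = 1 + \<delta> * L" if "c' \<in> {0..<1}" for c'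
    using closed_formula_eq[of c' m] idle_iff[OF that, of m] that unfolding assms by auto
  \<comment> \<open>With \<open>m\<close> fixed, \<open>F c' = 1 - lam\<close> makes
    \<open>(m, c')\<close> another solution of the parameter equation.\<close>
  have "c' = c" if "c' \<in> {0..<1}" "1 - lam = F c'" for c'
    using ex1_params[OF L] mc that F by blast
  moreover have "int m = \<lfloor>m_tilde\<rfloor>"
  proof -
    \<comment> \<open>Regroups the argument of the logarithm in \<open>m_tilde\<close> into the form
      used by \<open>bracket_iff_floor\<close>.\<close>
    have "1 / y + (L - 1) * ((1 - y) / y) = 1 + L * (1 / y - 1)"
      using \<eta>_pos unfolding assms(6) by (simp add: field_simps)
    then have "m_tilde = ln (1 + L * (1 / y - 1)) / ln (1 / y)"
      unfolding assms(8) L_def by simp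
    then show ?thesis
      using idle_odds_bracket[OF mc(1) mc(2)[symmetric]] idle_odds_bracket_iff bracket_iff_floor[OF L]
      unfolding assms(6) by metis
  qed
  ultimately show ?thesis
    using mc F by blast
qed

end
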